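(* Let $n\ge 2k+2$ and $k\ge 4$ be integers, and let $\mathcal{F}_1,\mathcal{F}_2,\dots,\mathcal{F}_h\subseteq\binom{[n]}{k}$ be families of $k$-element subsets of $[n]=\{1,\dots,n\}$ such that: (i) $\mathcal{F}_i\cap\mathcal{F}_j=\emptyset$ for all $1\le i<j\le h$; (ii) $F\cap F'=\emptyset$ for every $i\in\{1,\dots,h\}$ and every pair of distinct sets $F,F'\in\mathcal{F}_i$; (iii) $F_i\cap F_j\neq\emptyset$ for all $1\le i<j\le h$ and all $F_i\in\mathcal{F}_i$, $F_j\in\mathcal{F}_j$. Then $\sum_{i=1}^h|\mathcal{F}_i|\le\binom{n-1}{k-1}$. *)

theory Defs
  imports Complex_Main
begin

end

theory Submission
  imports Defs "HOL-Library.FuncSet"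
begin

text \<open>
  On the union of the families disjointness is an equivalence relation (once made reflexive), and we may
  assume that no class has more than \<open>k\<close> members, since a \<open>k\<close>-set cannot meet \<open>k + 1\<close> disjoint sets.
  As in Katona's proof of the Erdos-Ko-Rado theorem it suffices that a cyclic ordering of the ground set
  contains on average at most \<open>k\<close> members of the union as arcs. The number of arcs is at most \<open>k + 1\<close>, and
  \<open>k + 1\<close> occurs essentially only for \<open>k + 1\<close> consecutive arcs, the first \<open>F = f\<^sub>1\<dots>f\<^sub>k\<close> and the
  last \<open>G = g\<^sub>1\<dots>g\<^sub>k\<close> being disjoint and followed by further points \<open>a\<close>, \<open>b\<close>. Moving \<open>a\<close> and \<open>b\<close>
  to obtain \<open>f\<^sub>1\<dots>f\<^bsub>k-1\<^esub> a f\<^sub>k g\<^sub>1 b g\<^sub>2\<dots>g\<^sub>k\<close> gives an ordering with at most \<open>k - 1\<close>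
  arcs, because every arc must now meet both \<open>F\<close> and \<open>G\<close>. An ordering that arises in this way from \<open>l\<close>
  places has at most \<open>k - l\<close> arcs, so the deficits compensate the excesses. The only other orderings with
  \<open>k + 1\<close> arcs occur for \<open>n = 2 * k + 2\<close> and odd \<open>k\<close>, where every second arc may belong to the family; they
  are compensated by the orderings obtained from two transpositions of adjacent points.
\<close>

section \<open>Periodic functions and sums along a path\<close>

lemma periodic_mod:
  fixes g :: "int \<Rightarrow> 'b"
  assumes per: "\<And>x. g (x + N) = g x"
  shows "g (x mod N) = g x"
proof -
  have nat: "g (x + int m * N) = g x" for x m
  proof (induction m)
    case (Suc m)
    then show ?case using per[of "x + int m * N"] by (simp add: algebra_simps)
  qed simp
  have mul: "g (x + m * N) = g x" for x m
  proof (cases "m \<ge> 0")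
    case True then show ?thesis using nat[of x "nat m"] by simp
  next
    case False then show ?thesis using nat[of "x + m * N" "nat (-m)"] by (simp add: algebra_simps)
  qed
  show ?thesis
    using mul[of "x mod N" "x div N"] by simp
qed

lemma sum_periodic_shift:
  fixes g :: "int \<Rightarrow> 'b::comm_monoid_add"
  assumes "N > 0" and per: "\<And>x. g (x + N) = g x"
  shows "(\<Sum>x\<in>{0..<N}. g (x + i)) = (\<Sum>x\<in>{0..<N}. g x)"
  by (rule sum.reindex_bij_witness[where i = "\<lambda>x. (x - i) mod N" and j = "\<lambda>x. (x + i) mod N"])
     (use \<open>N > 0\<close> periodic_mod[of g, OF per] in \<open>auto simp: mod_simps\<close>)

lemma int_dvd_small: "(N::int) dvd x \<Longrightarrow> \<bar>x\<bar> < N \<Longrightarrow> x = 0"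
  using zdvd_not_zless[of "\<bar>x\<bar>" N] by auto

text \<open>Each 2 is compensated by the 0 after it; only a 2 at the right end \<open>b\<close>
  lacks such a partner.\<close>

lemma path_sum_le:
  fixes f :: "int \<Rightarrow> int"
  assumes "a \<le> b" and bd: "\<And>j. 0 \<le> f j \<and> f j \<le> 2"
    and fl: "\<And>j. a \<le> j \<Longrightarrow> j < b \<Longrightarrow> f j = 2 \<Longrightarrow> f (j + 1) = 0"
  shows "(\<Sum>j\<in>{a..b}. f j) \<le> b - a + 1 + of_bool (f b = 2)"
  using \<open>a \<le> b\<close> fl
proof (induction b rule: int_ge_induct)
  case base then show ?case using bd[of a] by auto
next
  case (step b)
  have "{a..b+1} = insert (b+1) {a..b}" using step.hyps by auto
  then have s: "(\<Sum>j\<in>{a..b+1}. f j) = f (b+1) + (\<Sum>j\<in>{a..b}. f j)" by simp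
  have "(\<Sum>j\<in>{a..b}. f j) \<le> b - a + 1 + of_bool (f b = 2)" using step by auto
  moreover have "f b = 2 \<Longrightarrow> f (b+1) = 0" using step.prems[of b] step.hyps by auto
  ultimately show ?case using s bd[of "b+1"] by (cases "f b = 2"; cases "f (b+1) = 2") auto
qed

text \<open>The first value other than 1 is a 0, since a 2 would need a 0 before it and
  \<open>f a \<noteq> 2\<close>. No earlier 2 uses up this 0, which saves 1 over
  \<open>path_sum_le\<close>.\<close>

lemma path_sum_less:
  fixes f :: "int \<Rightarrow> int"
  assumes "a \<le> b" and bd: "\<And>j. 0 \<le> f j \<and> f j \<le> 2" and fa: "f a \<noteq> 2"
    and fl: "\<And>j. a \<le> j \<Longrightarrow> j < b \<Longrightarrow> f j = 2 \<Longrightarrow> f (j + 1) = 0"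
    and fl': "\<And>j. a < j \<Longrightarrow> j \<le> b \<Longrightarrow> f j = 2 \<Longrightarrow> f (j - 1) = 0"
    and ex: "\<exists>j\<in>{a..b}. f j \<noteq> 1"
  shows "(\<Sum>j\<in>{a..b}. f j) \<le> b - a + of_bool (f b = 2)"
  using \<open>a \<le> b\<close> fl fl' ex
proof (induction b rule: int_ge_induct)
  case base then show ?case using bd[of a] fa by auto
next
  case (step b)
  have "{a..b+1} = insert (b+1) {a..b}" using step.hyps by auto
  then have s: "(\<Sum>j\<in>{a..b+1}. f j) = f (b+1) + (\<Sum>j\<in>{a..b}. f j)" by simp
  show ?case
  proof (cases "\<exists>j\<in>{a..b}. f j \<noteq> 1")
    case True
    then have "(\<Sum>j\<in>{a..b}. f j) \<le> b - a + of_bool (f b = 2)" using step by auto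
    moreover have "f b = 2 \<Longrightarrow> f (b+1) = 0" using step.prems(1)[of b] step.hyps by auto
    ultimately show ?thesis using s bd[of "b+1"] by (cases "f b = 2"; cases "f (b+1) = 2") auto
  next
    case False
    then have "(\<Sum>j\<in>{a..b}. f j) = (\<Sum>j\<in>{a..b}. 1)" by (intro sum.cong) auto
    then have s1: "(\<Sum>j\<in>{a..b}. f j) = b - a + 1" using step.hyps by simp
    have "f (b+1) \<noteq> 1"
    proof
      assume b1: "f (b+1) = 1"
      obtain j where "j \<in> {a..b+1}" "f j \<noteq> 1" using step.prems(3) by auto
      then show False using b1 False by (cases "j = b+1") auto
    qed
    moreover have "f (b+1) \<noteq> 2" using step.prems(2)[of "b+1"] False step.hyps by auto
    ultimately have "f (b+1) = 0" using bd[of "b+1"] by linarith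
    then show ?thesis using s s1 by simp
  qed
qed

section \<open>Cluster families of arcs on one circle\<close>

text \<open>Disjointness, on a circle of length \<open>N\<close>, of the arcs of length \<open>K\<close> that start at \<open>s\<close> and \<open>t\<close>;
  \<open>P s\<close> below says that the arc starting at \<open>s\<close> belongs to the family.\<close>

definition arcs_disjoint :: "int \<Rightarrow> int \<Rightarrow> int \<Rightarrow> int \<Rightarrow> bool" where
  "arcs_disjoint N K s t \<longleftrightarrow> K \<le> (t - s) mod N \<and> (t - s) mod N \<le> N - K"

locale arc_cluster =
  fixes N K :: int and P :: "int \<Rightarrow> bool"
  assumes K: "4 \<le> K" and N: "2 * K + 2 \<le> N"
    and per: "P (x + N) \<longleftrightarrow> P x"
    and disj_trans: "\<lbrakk>P s; P t; P u; arcs_disjoint N K s t; arcs_disjoint N K t u\<rbrakk>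
      \<Longrightarrow> N dvd u - s \<or> arcs_disjoint N K s u"
    and clique: "\<lbrakk>S \<subseteq> {0..<N}; \<And>s. s \<in> S \<Longrightarrow> P s;
        \<And>s t. s \<in> S \<Longrightarrow> t \<in> S \<Longrightarrow> s \<noteq> t \<Longrightarrow> arcs_disjoint N K s t\<rbrakk> \<Longrightarrow> int (card S) \<le> K"
begin

abbreviation dj where "dj \<equiv> arcs_disjoint N K"

definition arc_count :: int where "arc_count = (\<Sum>x\<in>{0..<N}. of_bool (P x))"

section \<open>Disjoint arcs in terms of their starting points\<close>

lemma dj_iff: "\<bar>t - s\<bar> < N \<Longrightarrow> dj s t \<longleftrightarrow> K \<le> \<bar>t - s\<bar> \<and> \<bar>t - s\<bar> \<le> N - K"
proof (cases "t \<ge> s")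
  case True
  assume "\<bar>t - s\<bar> < N"
  then show ?thesis using True K N by (simp add: arcs_disjoint_def)
next
  case False
  assume a: "\<bar>t - s\<bar> < N"
  have "(t - s) mod N = (t - s + N) mod N" by simp
  also have "\<dots> = t - s + N" using a False K N by (intro mod_pos_pos_trivial) auto
  finally show ?thesis using a False K N by (auto simp add: arcs_disjoint_def)
qed

lemma djI: "K \<le> \<bar>t - s\<bar> \<Longrightarrow> \<bar>t - s\<bar> \<le> N - K \<Longrightarrow> dj s t"
  using dj_iff[of t s] K by auto

lemma not_dj: "\<bar>t - s\<bar> < K \<Longrightarrow> \<not> dj s t"
  using dj_iff[of t s] K N by auto

text \<open>By transitivity of disjointness, no member is disjoint from two distinct overlapping
  members. This is the source of the local exclusions below.\<close>

lemma no_disjoint_path: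
  assumes "P s" "P t" "P u" "K \<le> \<bar>t - s\<bar>" "\<bar>t - s\<bar> \<le> N - K" "K \<le> \<bar>u - t\<bar>" "\<bar>u - t\<bar> \<le> N - K"
    "\<bar>u - s\<bar> < K" "u \<noteq> s"
  shows False
  using disj_trans[OF assms(1-3)] djI assms not_dj[of u s] int_dvd_small[of N "u - s"] N K by auto

lemma per_minus: "P (x - N) \<longleftrightarrow> P x" using per[of "x - N"] by simp

lemma per_mod: "P (x mod N) \<longleftrightarrow> P x"
  by (rule periodic_mod) (rule per)

text \<open>If \<open>N = 2 * K + 2\<close>, two opposite arcs form a column: an arc is disjoint exactly from the
  opposite arc and from its two neighbours, so the columns next to a full column are empty.\<close>

definition col :: "int \<Rightarrow> int" where "col x = of_bool (P x) + of_bool (P (x + K + 1))"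

lemma col_bd: "0 \<le> col x \<and> col x \<le> 2" by (simp add: col_def)

lemma col_eq_2: "col x = 2 \<longleftrightarrow> P x \<and> P (x + K + 1)"
  by (cases "P x"; cases "P (x + K + 1)") (auto simp: col_def)

lemma col_eq_0: "col x = 0 \<longleftrightarrow> \<not> P x \<and> \<not> P (x + K + 1)"
  by (cases "P x"; cases "P (x + K + 1)") (auto simp: col_def)

lemma col_per: "col (x + N) = col x"
  using per[of x] per[of "x + K + 1"] by (simp add: col_def algebra_simps)

lemma col_flank:
  assumes NN: "N = 2 * K + 2" and "col x = 2"
  shows "col (x + 1) = 0" "col (x - 1) = 0"
proof -
  have p: "P x" "P (x + K + 1)" using assms(2) by (auto simp: col_eq_2)
  have "\<not> P (x + 1)" using no_disjoint_path[OF p, of "x + 1"] K NN by auto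
  moreover have "\<not> P (x + 1 + K + 1)" using no_disjoint_path[OF p(2,1), of "x + 1 + K + 1"] K NN by auto
  moreover have "\<not> P (x - 1)" using no_disjoint_path[OF p, of "x - 1"] K NN by auto
  moreover have "\<not> P (x - 1 + K + 1)" using no_disjoint_path[OF p(2,1), of "x - 1 + K + 1"] K NN by auto
  ultimately show "col (x + 1) = 0" "col (x - 1) = 0" by (auto simp: col_def)
qed

section \<open>Extremal counts on circles of length \<open>2 * K + 2\<close>\<close>

lemma sum_col: "(\<Sum>x\<in>{0..<N}. col x) = 2 * arc_count"
proof -
  have "(\<Sum>x\<in>{0..<N}. of_bool (P (x + (K + 1))) :: int) = arc_count"
    unfolding arc_count_def
    by (rule sum_periodic_shift[where g = "\<lambda>x. of_bool (P x)"]) (use per K N in auto)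
  then show ?thesis
    unfolding col_def sum.distrib by (simp only: arc_count_def add.assoc)
qed

text \<open>Shifting the indicator of full columns by one charges each full column to its successor,
  which is empty by \<open>col_flank\<close>; so no summand is negative.\<close>

lemma arc_count_cols:
  assumes NN: "N = 2 * K + 2"
  shows "2 * arc_count = N - (\<Sum>x\<in>{0..<N}. of_bool (col x = 0) - of_bool (col (x - 1) = 2))"
proof -
  have "col x = 1 + of_bool (col x = 2) - of_bool (col x = 0)" for x
    by (auto simp: col_def)
  then have "(\<Sum>x\<in>{0..<N}. col x)
      = (\<Sum>x\<in>{0..<N}. 1 + of_bool (col x = 2) - of_bool (col x = 0))" by metis
  also have "\<dots> = N + (\<Sum>x\<in>{0..<N}. of_bool (col x = 2)) - (\<Sum>x\<in>{0..<N}. of_bool (col x = 0))"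
    using N K by (simp add: sum.distrib sum_subtractf)
  also have "(\<Sum>x\<in>{0..<N}. of_bool (col x = 2)) = (\<Sum>x\<in>{0..<N}. of_bool (col (x + - 1) = 2) :: int)"
    using sum_periodic_shift[of N "\<lambda>x. of_bool (col x = 2) :: int" "-1"] col_per N K by simp
  finally show ?thesis using sum_col by (simp add: sum_subtractf)
qed

lemma arc_count_tight:
  assumes NN: "N = 2 * K + 2"
  shows "arc_count \<le> K + 1"
proof -
  have "(of_bool (col x = 0) - of_bool (col (x - 1) = 2) :: int) \<ge> 0" for x
    using col_flank(1)[OF NN, of "x - 1"] by auto
  then have "(\<Sum>x\<in>{0..<N}. of_bool (col x = 0) - of_bool (col (x - 1) = 2) :: int) \<ge> 0"
    by (intro sum_nonneg) auto
  then show ?thesis using arc_count_cols[OF NN] NN by linarith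
qed

text \<open>Equality forces the empty columns to be exactly the successors of full ones. Either full
  and empty columns alternate, or every column holds exactly one arc.\<close>

lemma arc_count_tight_eq:
  assumes NN: "N = 2 * K + 2" and eq: "arc_count = K + 1"
  shows "(\<exists>i. P i \<and> P (i + 1) \<and> P (i + (K - 1)) \<and> P (i + K)) \<or>
         (odd K \<and> (\<exists>e\<in>{0,1}. \<forall>s. P s \<longleftrightarrow> even (s - e)))"
proof -
  have nn: "(of_bool (col x = 0) - of_bool (col (x - 1) = 2) :: int) \<ge> 0" for x
    using col_flank(1)[OF NN, of "x - 1"] by auto
  have "(\<Sum>x\<in>{0..<N}. of_bool (col x = 0) - of_bool (col (x - 1) = 2) :: int) = 0"
    using arc_count_cols[OF NN] NN eq by linarith
  then have "\<forall>x\<in>{0..<N}. (of_bool (col x = 0) - of_bool (col (x - 1) = 2) :: int) = 0"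
    using nn by (subst (asm) sum_nonneg_eq_0_iff) auto
  then have z0: "\<forall>x\<in>{0..<N}. col x = 0 \<longleftrightarrow> col (x - 1) = 2" by auto
  have col_mod: "col (x mod N) = col x" for x
    by (rule periodic_mod) (rule col_per)
  have z: "col x = 0 \<longleftrightarrow> col (x - 1) = 2" for x
  proof -
    have "x mod N \<in> {0..<N}" using N K by simp
    then have "col (x mod N) = 0 \<longleftrightarrow> col (x mod N - 1) = 2" using z0 by blast
    moreover have "col (x mod N - 1) = col (x - 1)"
      using col_mod[of "x mod N - 1"] col_mod[of "x - 1"] by (simp add: mod_simps)
    ultimately show ?thesis by (simp add: col_mod)
  qed
  show ?thesis
  proof (cases "\<exists>j. col j = 2")
    case True
    then obtain j where j: "col j = 2" by auto
    \<comment> \<open>The column before a full one is empty, hence itself preceded by a full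
      one.\<close>
    have dn: "col (x - 2) = 2" if "col x = 2" for x
      using col_flank(2)[OF NN that] z[of "x - 1"] by simp
    have dn': "col (j - 2 * int m) = 2" for m
    proof (induction m)
      case 0 then show ?case using j by simp
    next
      case (Suc m) then show ?case using dn[of "j - 2 * int m"] by (simp add: algebra_simps)
    qed
    have two: "col x = 2" if "even (x - j)" for x
    proof -
      \<comment> \<open>\<open>y\<close> is congruent to \<open>x\<close> and, as \<open>N\<close>
        is even, lies an even distance below \<open>j\<close>.\<close>
      define y where "y = j - ((j - x) mod N)"
      have "even ((j - x) mod N)"
        using that NN by (simp add: dvd_mod_iff)
      then obtain m where m: "(j - x) mod N = 2 * m" by (elim evenE)
      moreover have "(j - x) mod N \<ge> 0" using N K by simp
      ultimately have "m \<ge> 0" by simp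
      then have "col y = 2" using dn'[of "nat m"] m by (simp add: y_def)
      moreover have "y mod N = x mod N" by (simp add: y_def mod_simps)
      ultimately show ?thesis using col_mod[of x] col_mod[of y] by simp
    qed
    have zero: "col x = 0" if "odd (x - j)" for x
      using that z[of x] two[of "x - 1"] by simp
    \<comment> \<open>The columns \<open>j\<close> and \<open>j + K + 1\<close> consist of the same
      two arcs, so they cannot be full and empty at once.\<close>
    have odd: "odd K"
    proof (rule ccontr)
      assume "\<not> odd K"
      then have "col (j + (K + 1)) = 0" by (intro zero) simp
      moreover have "P (j + (K + 1))" using j by (auto simp: col_eq_2 add.assoc)
      ultimately show False by (auto simp: col_eq_0)
    qed
    have ev: "P s \<longleftrightarrow> even (s - j)" for s
      using two[of s] zero[of s] by (cases "even (s - j)") (auto simp: col_eq_2 col_eq_0)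
    have "\<exists>e\<in>{0,1}. \<forall>s. P s \<longleftrightarrow> even (s - e)"
    proof (cases "even j")
      case True
      then show ?thesis using ev by (intro bexI[of _ 0]) auto
    next
      case False
      then show ?thesis using ev by (intro bexI[of _ 1]) auto
    qed
    then show ?thesis using odd by blast
  next
    case False
    have one: "col x = 1" for x
    proof -
      have "col x \<noteq> 0" "col x \<noteq> 2" using z[of x] False by auto
      then show ?thesis using col_bd[of x] by linarith
    qed
    have flip: "P (x + K + 1) \<longleftrightarrow> \<not> P x" for x
      using one[of x] by (cases "P x"; cases "P (x + K + 1)") (auto simp: col_def)
    have "\<exists>j. P j \<and> \<not> P (j + 1)"
    proof (rule ccontr)
      assume "\<not> ?thesis"
      then have up: "P j \<Longrightarrow> P (j + 1)" for j by auto
      have up': "P j \<Longrightarrow> P (j + int m)" for j m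
      proof (induction m)
        case (Suc m) then show ?case using up[of "j + int m"] by (simp add: algebra_simps)
      qed simp
      obtain j where "P j" using flip[of 0] by auto
      then show False using up'[of j "nat (K + 1)"] flip[of j] K by (simp add: algebra_simps)
    qed
    then obtain j where j: "P j" "\<not> P (j + 1)" by auto
    \<comment> \<open>The arc opposite to \<open>j + 1\<close>; modulo \<open>N\<close>, the arc at
      \<open>i + K\<close> is the one at \<open>j\<close>.\<close>
    define i where "i = j + 1 + K + 1"
    have i: "P i" using flip[of "j + 1"] j by (simp add: i_def)
    have iK: "P (i + K)" using j per[of j] NN by (simp add: i_def algebra_simps)
    have "P (i + 1)"
    proof (rule ccontr)
      assume "\<not> P (i + 1)"
      then have "P (i + 1 + K + 1)" using flip[of "i + 1"] by simp
      then show False using no_disjoint_path[OF iK i, of "i + 1 + K + 1"] K NN by auto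
    qed
    moreover have "P (i + (K - 1))"
    proof (rule ccontr)
      assume "\<not> P (i + (K - 1))"
      then have "P (i + (K - 1) + K + 1)" using flip[of "i + (K - 1)"] by simp
      then have "P (i - 2)" using per_minus[of "i + (K - 1) + K + 1"] NN by (simp add: algebra_simps)
      then show False using no_disjoint_path[OF i iK, of "i - 2"] K NN by auto
    qed
    ultimately show ?thesis using i iK by blast
  qed
qed

section \<open>Intersecting families, disjoint triples and longer circles\<close>

lemma arc_count_shift: "arc_count = int (card {x\<in>{0..<N}. P (x + i)})"
proof -
  have "arc_count = (\<Sum>x\<in>{0..<N}. of_bool (P (x + i)))"
    unfolding arc_count_def
    by (rule sum_periodic_shift[where g = "\<lambda>x. of_bool (P x)", symmetric]) (use per K N in auto)
  then show ?thesis by (simp add: Int_def)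
qed

lemma dj_mod_cong: "s mod N = s' mod N \<Longrightarrow> t mod N = t' mod N \<Longrightarrow> dj s t \<longleftrightarrow> dj s' t'"
  unfolding arcs_disjoint_def by (metis mod_diff_cong)

lemma dj_sym: "dj s t \<longleftrightarrow> dj t s"
  using zmod_zminus1_eq_if[of "t - s" N] K N by (auto simp: arcs_disjoint_def)

text \<open>Katona's argument: all starts lie within distance less than \<open>K\<close> of a fixed
  member \<open>s\<close>, and starts that differ by \<open>N - K\<close> exclude each other.
  Folding these pairs leaves \<open>K\<close> places.\<close>

lemma intersecting_count:
  assumes nd: "\<And>s t. P s \<Longrightarrow> P t \<Longrightarrow> \<not> dj s t"
  shows "arc_count \<le> K"
proof (cases "\<exists>s. P s")
  case False
  then show ?thesis using K by (simp add: arc_count_def)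
next
  case True
  then obtain s where s: "P s" by auto
  define S where "S = {x\<in>{0..<N}. P (x + s)}"
  have rng: "x < K \<or> x > N - K" if "x \<in> S" for x
  proof (rule ccontr)
    assume "\<not> ?thesis"
    then have "dj s (x + s)" using djI[of "x + s" s] that by (auto simp: S_def)
    then show False using nd[OF s, of "x + s"] that by (auto simp: S_def)
  qed
  define \<phi> where "\<phi> x = (if x < K then x else x - (N - K))" for x
  have no: "\<not> (x \<in> S \<and> x + (N - K) \<in> S)" for x
    using nd[of "x + s" "x + (N - K) + s"] djI[of "x + (N - K) + s" "x + s"] K N by (auto simp: S_def)
  have "inj_on \<phi> S"
  proof (rule inj_onI)
    fix x y assume "x \<in> S" "y \<in> S" "\<phi> x = \<phi> y"
    moreover from this have "x \<noteq> y + (N - K)" "y \<noteq> x + (N - K)" using no[of x] no[of y] by auto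
    ultimately show "x = y" by (auto simp: \<phi>_def split: if_splits)
  qed
  moreover have "\<phi> x \<in> {0..<K}" if "x \<in> S" for x
    using rng[OF that] that K by (auto simp: \<phi>_def S_def split: if_splits)
  ultimately have "card S \<le> card {0..<K}" by (intro card_inj_on_le[of \<phi>]) auto
  then show ?thesis using arc_count_shift[of s] K by (simp add: S_def)
qed

text \<open>Lifts overlap on the circle to a distance bound on the line.\<close>

lemma near_rep:
  assumes "\<not> dj u x"
  obtains x' where "x' mod N = x mod N" "\<bar>x' - u\<bar> < K"
proof (cases "(x - u) mod N < K")
  case True
  have "(u + (x - u) mod N) mod N = x mod N" by (simp add: mod_simps)
  moreover have "\<bar>u + (x - u) mod N - u\<bar> < K" using True N K by simp
  ultimately show ?thesis by (rule that)
next
  case False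
  then have "(x - u) mod N > N - K" using assms by (simp add: arcs_disjoint_def)
  moreover have "(x - u) mod N < N" using N K by simp
  moreover have "(u + (x - u) mod N - N) mod N = x mod N" by (simp add: mod_simps)
  ultimately show ?thesis using that[of "u + (x - u) mod N - N"] N K by linarith
qed

text \<open>A member other than \<open>s\<close> that meets \<open>s\<close> would by transitivity
  meet \<open>t\<close> and \<open>w\<close> too. Three starts pairwise at least \<open>K\<close>
  apart cannot all be within distance less than \<open>K\<close> of one start. So all members are
  pairwise disjoint, and \<open>clique\<close> applies.\<close>

lemma triple_count:
  assumes P: "P s" "P t" "P w" and d: "dj s t" "dj s w" "dj t w"
  shows "arc_count \<le> K"
proof -
  have star: "N dvd u - s \<or> dj s u" if u: "P u" for u
  proof (rule ccontr)
    assume c: "\<not> ?thesis"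
    have "\<not> dj t u" using disj_trans[OF P(1,2) u d(1)] c by auto
    moreover have "\<not> dj w u" using disj_trans[OF P(1,3) u d(2)] c by auto
    ultimately have nd: "\<not> dj u s" "\<not> dj u t" "\<not> dj u w" using c dj_sym by auto
    obtain s' where s': "s' mod N = s mod N" "\<bar>s' - u\<bar> < K" using near_rep[OF nd(1)] by metis
    obtain t' where t': "t' mod N = t mod N" "\<bar>t' - u\<bar> < K" using near_rep[OF nd(2)] by metis
    obtain w' where w': "w' mod N = w mod N" "\<bar>w' - u\<bar> < K" using near_rep[OF nd(3)] by metis
    have "dj s' t'" "dj s' w'" "dj t' w'"
      using d dj_mod_cong[OF s'(1) t'(1)] dj_mod_cong[OF s'(1) w'(1)] dj_mod_cong[OF t'(1) w'(1)] by auto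
    then have "K \<le> \<bar>t' - s'\<bar>" "K \<le> \<bar>w' - s'\<bar>" "K \<le> \<bar>w' - t'\<bar>"
      using not_dj by (meson not_le)+
    then show False using s'(2) t'(2) w'(2) by linarith
  qed
  define S where "S = {x\<in>{0..<N}. P (x + 0)}"
  have "int (card S) \<le> K"
  proof (rule clique)
    fix x y assume xy: "x \<in> S" "y \<in> S" "x \<noteq> y"
    then have Pxy: "P x" "P y" by (auto simp: S_def)
    have "\<bar>y - x\<bar> < N" using xy by (auto simp: S_def abs_if)
    then have nxy: "\<not> N dvd y - x" using xy int_dvd_small[of N "y - x"] by auto
    have *: "dj x y" if "N dvd x - s" "P y" "\<not> N dvd y - x" for x y
    proof -
      have "\<not> N dvd y - s" using that dvd_diff[of N "y - s" "x - s"] by auto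
      then have "dj s y" using star[OF that(2)] by auto
      moreover have "s mod N = x mod N" using that(1) by (metis mod_eq_dvd_iff)
      ultimately show ?thesis using dj_mod_cong[of s x y y] by auto
    qed
    show "dj x y"
    proof (cases "N dvd x - s")
      case True then show ?thesis using * Pxy nxy by blast
    next
      case False
      then have "dj x s" using star[OF Pxy(1)] dj_sym by blast
      show ?thesis
      proof (cases "N dvd y - s")
        case True
        moreover have "\<not> N dvd x - y" using nxy by (simp add: dvd_diff_commute)
        ultimately show ?thesis using *[of y x] Pxy dj_sym by blast
      next
        case False
        then have "dj s y" using star[OF Pxy(2)] by auto
        then show ?thesis using disj_trans[OF Pxy(1) P(1) Pxy(2) \<open>dj x s\<close>] nxy by auto
      qed
    qed
  qed (auto simp: S_def)
  then show ?thesis using arc_count_shift[of 0] by (simp add: S_def)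
qed

text \<open>When neither \<open>intersecting_count\<close> nor \<open>triple_count\<close> applies,
  fix disjoint members \<open>s\<close> and \<open>s + y\<close>. All other members meet both, so
  their starts lie in two windows; overlaying the windows gives a path sum in which each 2 is
  flanked by 0s.\<close>

lemma arc_count_wide:
  assumes NN: "N \<ge> 2 * K + 3"
  shows "arc_count \<le> K \<or> (arc_count = K + 1 \<and> (\<exists>i. \<forall>j\<in>{0..K}. P (i + j)))"
proof (cases "\<exists>s t. P s \<and> P t \<and> dj s t")
  case False
  then show ?thesis using intersecting_count by blast
next
  case True
  then obtain s0 t0 where st0: "P s0" "P t0" "dj s0 t0" by auto
  \<comment> \<open>Distances between disjoint members. The least one satisfies
    \<open>2 * y \<le> N\<close>, because \<open>N - y\<close> is such a distance as well.\<close>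
  define Y where "Y = {y\<in>{K..N-K}. \<exists>s. P s \<and> P (s + y)}"
  have "P (s0 + (t0 - s0) mod N)"
    using st0(2) per_mod[of "s0 + (t0 - s0) mod N"] per_mod[of t0] by (simp add: mod_simps)
  then have "(t0 - s0) mod N \<in> Y" using st0 by (auto simp: Y_def arcs_disjoint_def)
  moreover have "finite Y" unfolding Y_def by (rule finite_subset[of _ "{K..N-K}"]) auto
  ultimately have yY: "Min Y \<in> Y" and ymin: "\<And>z. z \<in> Y \<Longrightarrow> Min Y \<le> z" by (auto intro: Min_in)
  define y where "y = Min Y"
  obtain s where y: "K \<le> y" "y \<le> N - K" "P s" "P (s + y)" using yY by (auto simp: Y_def y_def)
  have "N - y \<in> Y" using y per[of s] by (auto simp: Y_def intro!: exI[of _ "s + y"])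
  then have yy: "2 * y \<le> N" using ymin[of "N - y"] by (simp add: y_def)
  have dsy: "dj s (s + y)" using y K by (intro djI) auto
  show ?thesis
  proof (cases "\<exists>w. P w \<and> dj s w \<and> dj (s + y) w")
    case True
    then show ?thesis using triple_count[OF y(3,4)] dsy by blast
  next
    case False
    define g where "g = y - K"
    \<comment> \<open>The offset has to lie strictly between \<open>K\<close> and
      \<open>N - K\<close>, so that moving either arc by one keeps the pair disjoint; for
      \<open>g = 0\<close> the value \<open>y = K\<close> would be too small.\<close>
    define m where "m = (if g = 0 then K + 1 else y)"
    have g: "0 \<le> g" "2 * g \<le> N - 2 * K" using y yy by (auto simp: g_def)
    have m: "K + 1 \<le> m" "m + 1 \<le> N - K" "m \<ge> y" using g NN y by (auto simp: m_def g_def)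
    define Near where "Near = {j\<in>{g+1..K-1}. P (s + j)}"
    define Far where "Far = {z\<in>{N-K+1..y+K-1}. P (s + z)}"
    define Far' where "Far' = {j\<in>{g+1..K-1}. j + m \<in> Far}"
    define S where "S = {z\<in>{0..<N}. P (z + s)}"
    have sub: "S \<subseteq> {0, y} \<union> (Near \<union> Far)"
    proof
      fix z assume "z \<in> S"
      then have z: "0 \<le> z" "z < N" "P (s + z)" by (auto simp: S_def algebra_simps)
      show "z \<in> {0, y} \<union> (Near \<union> Far)"
      proof (rule ccontr)
        assume c: "z \<notin> {0, y} \<union> (Near \<union> Far)"
        have "\<not> dj s (s + z)"
        proof
          assume d: "dj s (s + z)"
          then have "N dvd s + z - (s + y) \<or> dj (s + y) (s + z)"
            using disj_trans[OF y(4,3) z(3)] dsy dj_sym by blast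
          then have "N dvd z - y" using False d z by auto
          then show False using int_dvd_small[of N "z - y"] c z y K by auto
        qed
        moreover have "\<not> dj (s + y) (s + z)"
        proof
          assume d: "dj (s + y) (s + z)"
          then have "N dvd s + z - s \<or> dj s (s + z)"
            using disj_trans[OF y(3,4) z(3)] dsy by blast
          then have "N dvd z" using \<open>\<not> dj s (s + z)\<close> by auto
          then show False using int_dvd_small[of N "z"] c z by auto
        qed
        ultimately have "z < K \<or> z > N - K" "\<bar>z - y\<bar> < K \<or> \<bar>z - y\<bar> > N - K"
          using dj_iff[of "s + z" s] dj_iff[of "s + z" "s + y"] z y K N by auto
        then show False using c z y yy K N by (auto simp: Near_def Far_def g_def)
      qed
    qed
    have fin: "finite Near" "finite Far" "finite Far'"
      unfolding Near_def Far_def Far'_def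
      by (rule finite_subset[of _ "{g+1..K-1}"] finite_subset[of _ "{N-K+1..y+K-1}"]; auto)+
    have far: "j \<in> {g+1..K-1}" if "j + m \<in> {N-K+1..y+K-1}" for j
      using that g y NN by (auto simp: m_def g_def split: if_splits)
    have "(\<lambda>z. z - m) ` Far \<subseteq> Far'" using far by (auto simp: Far'_def Far_def)
    then have cF: "card Far \<le> card Far'"
      by (rule card_inj_on_le[rotated]) (auto simp: inj_on_def fin)
    have "card S \<le> card ({0, y} \<union> (Near \<union> Far))" using sub fin by (intro card_mono) auto
    also have "\<dots> \<le> card {0, y} + card (Near \<union> Far)" by (rule card_Un_le)
    also have "\<dots> \<le> 2 + (card Near + card Far)"
      using card_Un_le[of Near Far] by (simp add: card_insert_if)
    finally have cS: "arc_count \<le> 2 + (int (card Near) + int (card Far'))"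
      using cF arc_count_shift[of s] by (simp add: S_def)
    define f where "f j = (of_bool (P (s + j)) + of_bool (j + m \<in> Far) :: int)" for j
    have fsum: "(\<Sum>j\<in>{g+1..K-1}. f j) = int (card Near) + int (card Far')"
      by (simp add: f_def sum.distrib Near_def Far'_def Int_def)
    have f2: "f j = 2 \<longleftrightarrow> P (s + j) \<and> j + m \<in> Far" for j
      by (cases "P (s + j)"; cases "j + m \<in> Far") (auto simp: f_def)
    have f0: "f j = 0 \<longleftrightarrow> \<not> P (s + j) \<and> j + m \<notin> Far" for j
      by (cases "P (s + j)"; cases "j + m \<in> Far") (auto simp: f_def)
    have bd: "0 \<le> f j \<and> f j \<le> 2" for j by (simp add: f_def)
    have fl: "f (j + 1) = 0 \<and> f (j - 1) = 0" if "f j = 2" for j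
    proof -
      have p: "P (s + j)" "P (s + j + m)" using that by (auto simp: f2 Far_def add.assoc)
      have "\<not> P (s + (j + 1))" using no_disjoint_path[OF p, of "s + (j + 1)"] m K by auto
      moreover have "\<not> P (s + (j - 1))" using no_disjoint_path[OF p, of "s + (j - 1)"] m K by auto
      moreover have "\<not> P (s + (j + 1 + m))" using no_disjoint_path[OF p(2,1), of "s + (j + 1 + m)"] m K by auto
      moreover have "\<not> P (s + (j - 1 + m))" using no_disjoint_path[OF p(2,1), of "s + (j - 1 + m)"] m K by auto
      ultimately show ?thesis by (auto simp: f0 Far_def)
    qed
    show ?thesis
    proof (cases "g + 1 \<le> K - 1")
      case False
      then have "Near = {}" "Far' = {}" by (auto simp: Near_def Far'_def)
      then show ?thesis using cS K by simp
    next
      case True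
      have le: "(\<Sum>j\<in>{g+1..K-1}. f j) \<le> K - 1 - (g + 1) + 1 + of_bool (f (K - 1) = 2)"
        using True bd fl by (intro path_sum_le) auto
      have le1: "(\<Sum>j\<in>{g+1..K-1}. f j) \<le> K - 1 - (g + 1) + of_bool (f (K - 1) = 2)"
        if "f (g + 1) \<noteq> 2" "\<exists>j\<in>{g+1..K-1}. f j \<noteq> 1"
        using True bd fl that by (intro path_sum_less) auto
      have all1: "(\<Sum>j\<in>{g+1..K-1}. f j) = K - 1 - (g + 1) + 1" if "\<forall>j\<in>{g+1..K-1}. f j = 1"
        using that True by simp
      \<comment> \<open>The sum is at most \<open>K - g\<close>, and \<open>s\<close> and
        \<open>s + y\<close> add 2. This suffices for \<open>g \<ge> 2\<close>; smaller gaps need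
        the values at the ends of the range.\<close>
      consider "g = 0" | "g = 1" | "g \<ge> 2" using g by linarith
      then show ?thesis
      proof cases
        case 1
        \<comment> \<open>At both ends \<open>j + m\<close> falls outside the window of
          \<open>Far\<close>.\<close>
        have e: "f (g + 1) \<noteq> 2" "f (K - 1) \<noteq> 2" using 1 NN by (auto simp: f2 Far_def m_def g_def)
        show ?thesis
        proof (cases "\<forall>j\<in>{g+1..K-1}. f j = 1")
          case False
          then show ?thesis using le1[OF e(1)] e(2) cS fsum 1 by auto
        next
          case one: True
          \<comment> \<open>The run grows from \<open>s\<close>: if the far arc were present instead
            of \<open>s + j\<close>, it would be disjoint from the two preceding members, which
            overlap.\<close>
          have "P (s + int j)" if "int j \<le> K - 1" for j
            using that
          proof (induction j rule: less_induct)
            case (less j)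
            consider "j = 0" | "j = 1" | "j \<ge> 2" by linarith
            then show ?case
            proof cases
              case 1 then show ?thesis using y by simp
            next
              case j1: 2
              have "f 1 = 1" using one 1 K by auto
              then show ?thesis using j1 1 NN by (auto simp: f_def Far_def m_def g_def split: if_splits)
            next
              case 3
              have p1: "P (s + int (j - 1))" and p2: "P (s + int (j - 2))" using less.IH[of "j - 1"] less.IH[of "j - 2"] less.prems 3 by simp_all
              have "f (int j) = 1" using one 1 3 less.prems by auto
              show ?thesis
              proof (rule ccontr)
                assume "\<not> ?thesis"
                then have "int j + m \<in> Far" using \<open>f (int j) = 1\<close> by (auto simp: f_def)
                then have "P (s + int j + (K + 1))" using 1 by (auto simp: Far_def m_def add.assoc)
                then show False using no_disjoint_path[OF p1 _ p2, of "s + int j + (K + 1)"] 3 K NN by auto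
              qed
            qed
          qed
          then have "P (s + j)" if "j \<in> {0..K-1}" for j using that by (metis atLeastAtMost_iff nat_0_le)
          moreover have "P (s + K)" using y(4) 1 by (simp add: g_def)
          ultimately have "\<forall>j\<in>{0..K}. P (s + j)" by (metis atLeastAtMost_iff zle_diff1_eq order_le_less)
          moreover have "arc_count \<le> K + 1" using cS fsum all1[OF one] 1 by simp
          ultimately show ?thesis by (cases "arc_count \<le> K") auto
        qed
      next
        case 2
        have e: "f (g + 1) \<noteq> 2" using 2 NN by (auto simp: f2 Far_def m_def g_def)
        have "(\<Sum>j\<in>{g+1..K-1}. f j) \<le> K - 1 - (g + 1) + 1"
        proof (cases "\<forall>j\<in>{g+1..K-1}. f j = 1")
          case True then show ?thesis using all1 by simp
        next
          case False then show ?thesis using le1[OF e] by (cases "f (K - 1) = 2") auto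
        qed
        then show ?thesis using cS fsum 2 by simp
      next
        case 3
        then show ?thesis using le cS fsum by (cases "f (K - 1) = 2") auto
      qed
    qed
  qed
qed

section \<open>Upper bounds for deficit circles\<close>

text \<open>Overlaying the two windows of starts with offset \<open>N - K - 1\<close> gives a path
  of \<open>K - 1\<close> places. There is no 2 at its end, because \<open>K + m = N - 1\<close>
  exceeds \<open>2 * K + 1\<close>.\<close>

lemma arc_count_wide_deficit:
  assumes NN: "N \<ge> 2 * K + 3"
    and rng: "\<And>s. 0 \<le> s \<Longrightarrow> s < N \<Longrightarrow> P s \<Longrightarrow> s \<in> {2..K} \<union> {N-K+1..2*K+1}"
  shows "arc_count \<le> K - 1"
proof -
  define m where "m = N - K - 1"
  define Near where "Near = {j\<in>{2..K}. P j}"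
  define Far where "Far = {j\<in>{2..K}. j + m \<le> 2 * K + 1 \<and> P (j + m)}"
  have fin: "finite Near" "finite Far"
    unfolding Near_def Far_def by (rule finite_subset[of _ "{2..K}"]; auto)+
  have "{x\<in>{0..<N}. P (x + 0)} \<subseteq> Near \<union> (\<lambda>j. j + m) ` Far"
  proof
    fix x assume "x \<in> {x\<in>{0..<N}. P (x + 0)}"
    then have x: "0 \<le> x" "x < N" "P x" by auto
    from rng[OF x] show "x \<in> Near \<union> (\<lambda>j. j + m) ` Far"
    proof
      assume "x \<in> {2..K}" then show ?thesis using x by (auto simp: Near_def)
    next
      assume "x \<in> {N-K+1..2*K+1}"
      then have "x - m \<in> Far" using x NN by (auto simp: Far_def m_def)
      then have "x - m + m \<in> (\<lambda>j. j + m) ` Far" by blast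
      then show ?thesis by simp
    qed
  qed
  then have "card {x\<in>{0..<N}. P (x + 0)} \<le> card (Near \<union> (\<lambda>j. j + m) ` Far)"
    using fin by (intro card_mono) auto
  also have "\<dots> \<le> card Near + card Far"
    using card_Un_le[of Near "(\<lambda>j. j + m) ` Far"] card_image_le[OF fin(2), of "\<lambda>j. j + m"] by linarith
  finally have c: "arc_count \<le> int (card Near) + int (card Far)" using arc_count_shift[of 0] by simp
  define f where "f j = (of_bool (P j) + of_bool (j + m \<le> 2 * K + 1 \<and> P (j + m)) :: int)" for j
  have f2: "f j = 2 \<longleftrightarrow> P j \<and> j + m \<le> 2 * K + 1 \<and> P (j + m)" for j
    by (cases "P j"; cases "j + m \<le> 2 * K + 1 \<and> P (j + m)") (auto simp: f_def)
  have fl: "f (j + 1) = 0" if "f j = 2" for j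
  proof -
    have p: "P j" "P (j + m)" using that by (auto simp: f2)
    have "\<not> P (j + 1)" using no_disjoint_path[OF p, of "j + 1"] NN K by (auto simp: m_def)
    moreover have "\<not> P (j + 1 + m)" using no_disjoint_path[OF p(2,1), of "j + 1 + m"] NN K by (auto simp: m_def)
    ultimately show ?thesis by (simp add: f_def)
  qed
  have "(\<Sum>j\<in>{2..K}. f j) \<le> K - 2 + 1 + of_bool (f K = 2)"
    using K fl by (intro path_sum_le) (auto simp: f_def)
  moreover have "f K \<noteq> 2" using NN by (auto simp: f2 m_def)
  moreover have "(\<Sum>j\<in>{2..K}. f j) = int (card Near) + int (card Far)"
    by (simp add: f_def sum.distrib Near_def Far_def Int_def)
  ultimately show ?thesis using c by simp
qed

text \<open>\<open>D\<close> will mark the rotations satisfying \<open>spread_run\<close>. A mark at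
  \<open>x\<close> makes the summands of \<open>arc_count_cols\<close> at \<open>x\<close>,
  \<open>x + 1\<close>, \<open>x + K + 1\<close> and \<open>x + K + 2\<close> equal to 1, and
  \<open>D1\<close> keeps the quadruples of different marks apart.\<close>

lemma arc_count_tight_deficit:
  assumes NN: "N = 2 * K + 2"
    and Dper: "\<And>x. D (x + N) \<longleftrightarrow> D x"
    and D0: "\<And>x. D x \<Longrightarrow> col x = 0 \<and> col (x + 1) = 0 \<and> col (x - 1) \<noteq> 2"
    and D1: "\<And>x. D x \<Longrightarrow> \<not> D (x + 1) \<and> \<not> D (x + K + 1) \<and> \<not> D (x + K + 2)"
  shows "arc_count \<le> K + 1 - 2 * (\<Sum>x\<in>{0..<N}. of_bool (D x))"
proof -
  have col_half: "col (y + K + 1) = col y" for y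
    using per[of y] NN by (simp add: col_def algebra_simps)
  have pt: "(of_bool (D x) + of_bool (D (x + -1)) + of_bool (D (x + -(K+1))) + of_bool (D (x + -(K+2))) :: int)
     \<le> of_bool (col x = 0) - of_bool (col (x - 1) = 2)" for x
  proof -
    have a: "D x \<Longrightarrow> col x = 0 \<and> col (x - 1) \<noteq> 2" using D0[of x] by auto
    have b: "D (x - 1) \<Longrightarrow> col x = 0 \<and> col (x - 1) \<noteq> 2" using D0[of "x - 1"] by auto
    have c: "D (x - (K+1)) \<Longrightarrow> col x = 0 \<and> col (x - 1) \<noteq> 2"
      using D0[of "x - (K+1)"] col_half[of "x - (K + 1)"] col_half[of "x - (K + 1) - 1"]
      by (auto simp: algebra_simps)
    have d: "D (x - (K+2)) \<Longrightarrow> col x = 0 \<and> col (x - 1) \<noteq> 2"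
      using D0[of "x - (K+2)"] col_half[of "x - (K + 2)"] col_half[of "x - (K + 2) + 1"]
      by (auto simp: algebra_simps)
    have ab: "\<not> (D x \<and> D (x - 1))" using D1[of "x - 1"] by auto
    have ac: "\<not> (D x \<and> D (x - (K+1)))" using D1[of "x - (K+1)"] by auto
    have ad: "\<not> (D x \<and> D (x - (K+2)))" using D1[of "x - (K+2)"] by auto
    have bc: "\<not> (D (x - 1) \<and> D (x - (K+1)))"
      using D1[of "x - 1"] Dper[of "x - (K+1)"] NN by (auto simp: algebra_simps)
    have bd: "\<not> (D (x - 1) \<and> D (x - (K+2)))"
      using D1[of "x - (K+2)"] by (auto simp: algebra_simps)
    have cd: "\<not> (D (x - (K+1)) \<and> D (x - (K+2)))"
      using D1[of "x - (K+2)"] by (auto simp: algebra_simps)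
    have fl: "col (x - 1) = 2 \<Longrightarrow> col x = 0" using col_flank(1)[OF NN, of "x - 1"] by auto
    have e: "x + -1 = x - 1" "x + -(K+1) = x - (K+1)" "x + -(K+2) = x - (K+2)" by auto
    show ?thesis unfolding e
      using a b c d ab ac ad bc bd cd fl
      by (cases "D x"; cases "D (x - 1)"; cases "D (x - (K+1))"; cases "D (x - (K+2))";
          cases "col (x - 1) = 2") auto
  qed
  have sh: "(\<Sum>x\<in>{0..<N}. of_bool (D (x + i)) :: int) = (\<Sum>x\<in>{0..<N}. of_bool (D x))" for i
    by (rule sum_periodic_shift[where g = "\<lambda>x. of_bool (D x)"]) (use Dper K N in auto)
  have "(\<Sum>x\<in>{0..<N}. of_bool (D x) + of_bool (D (x + -1)) + of_bool (D (x + -(K+1))) + of_bool (D (x + -(K+2))) :: int)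
     \<le> (\<Sum>x\<in>{0..<N}. of_bool (col x = 0) - of_bool (col (x - 1) = 2))"
    by (rule sum_mono) (rule pt)
  then have "4 * (\<Sum>x\<in>{0..<N}. of_bool (D x) :: int)
     \<le> (\<Sum>x\<in>{0..<N}. of_bool (col x = 0) - of_bool (col (x - 1) = 2))"
    unfolding sum.distrib sh by linarith
  then show ?thesis using arc_count_cols[OF NN] NN by linarith
qed

end

section \<open>Averaging over circles\<close>

text \<open>A circle is a cyclic ordering of \<open>V\<close>, stored as an \<open>N\<close>-periodic labelling of the integers.\<close>

definition circles :: "int \<Rightarrow> 'a set \<Rightarrow> (int \<Rightarrow> 'a) set" where
  "circles N V = {c. (\<forall>x y. c x = c y \<longleftrightarrow> N dvd x - y) \<and> range c = V}"

definition arc :: "int \<Rightarrow> (int \<Rightarrow> 'a) \<Rightarrow> int \<Rightarrow> 'a set" where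
  "arc K c s = c ` {s..<s + K}"

definition rot :: "int \<Rightarrow> (int \<Rightarrow> 'a) \<Rightarrow> int \<Rightarrow> 'a" where
  "rot i c = (\<lambda>x. c (x + i))"

section \<open>Elementary properties of arcs\<close>

lemma arc_rot: "arc K (rot i c) s = arc K c (s + i)"
proof -
  have "(\<lambda>x. x + i) ` {s..<s + K} = {s + i..<s + i + K}"
    by (simp add: algebra_simps)
  then show ?thesis unfolding arc_def rot_def by (metis image_image)
qed

lemma circles_eq_iff: "c \<in> circles N V \<Longrightarrow> c x = c y \<longleftrightarrow> N dvd x - y"
  by (simp add: circles_def)

lemma circles_periodic: "c \<in> circles N V \<Longrightarrow> c (x + N) = c x"
  by (simp add: circles_eq_iff)

lemma circles_mem_image:
  assumes "c \<in> circles N V" "T \<subseteq> {a..<a + N}" "x \<in> {a..<a + N}"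
  shows "c x \<in> c ` T \<longleftrightarrow> x \<in> T"
proof
  assume "c x \<in> c ` T"
  then obtain y where y: "y \<in> T" "c x = c y" by auto
  then have "N dvd x - y" using assms(1) circles_eq_iff by metis
  moreover have "\<bar>x - y\<bar> < N" using assms y by (auto simp: abs_if)
  ultimately have "x = y" using int_dvd_small by fastforce
  then show "x \<in> T" using y by simp
qed auto

lemma circles_image_disjoint:
  assumes "c \<in> circles N V" "S \<subseteq> {a..b}" "T \<subseteq> {a'..b'}" "b < a'" "b' < a + N"
  shows "c ` S \<inter> c ` T = {}"
proof -
  have False if "x \<in> S" "y \<in> T" "c x = c y" for x y
  proof -
    have "N dvd x - y" using that assms(1) circles_eq_iff by metis
    moreover have "\<bar>x - y\<bar> < N" "x \<noteq> y" using subsetD[OF assms(2)] subsetD[OF assms(3)] assms(4,5) that by force+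
    ultimately show False using int_dvd_small by fastforce
  qed
  then show ?thesis by blast
qed

lemma arc_periodic:
  assumes "c \<in> circles N V" "s mod N = t mod N"
  shows "arc K c s = arc K c t"
proof -
  have d: "N dvd s - t" using assms(2) by (simp add: mod_eq_dvd_iff)
  have "c (x + s) = c (x + t)" for x using assms(1) d by (simp add: circles_eq_iff)
  then have "rot s c = rot t c" by (simp add: rot_def)
  then show ?thesis using arc_rot[of K s c 0] arc_rot[of K t c 0] by simp
qed

lemma arc_disjoint_iff:
  assumes c: "c \<in> circles N V" and "0 < K" "K \<le> N"
  shows "arc K c s \<inter> arc K c t = {} \<longleftrightarrow> arcs_disjoint N K s t"
proof -
  define d where "d = (t - s) mod N"
  have d: "0 \<le> d" "d < N" using assms by (auto simp: d_def)
  have t: "arc K c t = arc K c (s + d)" by (rule arc_periodic[OF c]) (simp add: d_def mod_simps)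
  show ?thesis
  proof
    assume "arcs_disjoint N K s t"
    then have "K \<le> d" "d \<le> N - K" by (auto simp: arcs_disjoint_def d_def)
    then show "arc K c s \<inter> arc K c t = {}" unfolding t unfolding arc_def
      by (intro circles_image_disjoint[OF c, of _ s "s + K - 1" _ "s + d" "s + d + K - 1"]) auto
  next
    assume e: "arc K c s \<inter> arc K c t = {}"
    show "arcs_disjoint N K s t"
    proof (rule ccontr)
      assume "\<not> ?thesis"
      then consider "d < K" | "d > N - K" by (auto simp: arcs_disjoint_def d_def)
      then show False
      proof cases
        case 1
        then have "c (s + d) \<in> arc K c s \<inter> arc K c t" using d assms unfolding t by (auto simp: arc_def)
        then show False using e by auto
      next
        case 2
        then have "c (s + N) \<in> arc K c t" using d unfolding t by (auto simp: arc_def)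
        moreover have "c (s + N) \<in> arc K c s" using circles_periodic[OF c] assms by (auto simp: arc_def)
        ultimately show False using e by auto
      qed
    qed
  qed
qed

text \<open>Used to recognise sets with an isolated point, such as \<open>T0\<close> and
  \<open>T3\<close> below, as sets that are not arcs.\<close>

lemma arc_connected:
  assumes c: "c \<in> circles N V" and "2 \<le> K" and x: "c x \<in> arc K c s"
  shows "c (x - 1) \<in> arc K c s \<or> c (x + 1) \<in> arc K c s"
proof -
  obtain y where y: "s \<le> y" "y < s + K" "c x = c y" using x by (auto simp: arc_def)
  then have d: "N dvd x - y" using circles_eq_iff[OF c] by metis
  then have "c (x - 1) = c (y - 1)" "c (x + 1) = c (y + 1)" by (auto simp: circles_eq_iff[OF c])
  moreover have "y - 1 \<in> {s..<s + K} \<or> y + 1 \<in> {s..<s + K}" using y assms(2) by auto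
  ultimately show ?thesis by (auto simp: arc_def)
qed

text \<open>The start is the only point of an arc whose predecessor lies outside it.\<close>

lemma arc_inj:
  assumes c: "c \<in> circles N V" and "0 < K" "K < N" and e: "arc K c s = arc K c u"
  shows "N dvd u - s"
proof -
  have "c s \<in> arc K c u" using e assms by (auto simp: arc_def)
  then obtain y where y: "u \<le> y" "y < u + K" "c s = c y" by (auto simp: arc_def)
  have d: "N dvd s - y" using y(3) circles_eq_iff[OF c] by metis
  have "y = u"
  proof (rule ccontr)
    assume "y \<noteq> u"
    then have "c (y - 1) \<in> arc K c s" using y e by (auto simp: arc_def)
    moreover have "c (y - 1) = c (s - 1)" using d by (auto simp: circles_eq_iff[OF c] dvd_diff_commute)
    moreover have "c (s - 1) \<notin> arc K c s" unfolding arc_def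
      by (subst circles_mem_image[OF c, where a = "s - 1"]) (use assms in auto)
    ultimately show False by simp
  qed
  then show ?thesis using d by (simp add: dvd_diff_commute)
qed

lemma card_arc:
  assumes c: "c \<in> circles N V" and "0 < K" "K < N"
  shows "int (card (arc K c s)) = K"
proof -
  have "inj_on c {s..<s + K}"
    by (rule inj_onI) (use circles_mem_image[OF c, where a = s, of "{_}"] assms in force)
  then show ?thesis unfolding arc_def using assms by (simp add: card_image)
qed

lemma arc_subset: "c \<in> circles N V \<Longrightarrow> arc K c s \<subseteq> V"
  by (auto simp: circles_def arc_def)

section \<open>Rearranging the places of a circle\<close>

text \<open>A map commuting with translation by \<open>N\<close> acts on residues, so
  \<open>p\<close> permutes the places.\<close>

lemma circles_comp:
  assumes c: "c \<in> circles N V"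
    and p: "\<And>x. p (x + N) = p x + N" "\<And>x. q (x + N) = q x + N" "\<And>x. p (q x) = x" "\<And>x. q (p x) = x"
  shows "c \<circ> p \<in> circles N V"
proof -
  have add: "f (x + m * N) = f x + m * N" if "\<And>x. f (x + N) = f x + N" for f :: "int \<Rightarrow> int" and x m
  proof -
    have pos: "f (x + int j * N) = f x + int j * N" for x j
    proof (induction j)
      case (Suc j)
      then show ?case using that[of "x + int j * N"] by (simp add: algebra_simps)
    qed simp
    show ?thesis
    proof (cases "m \<ge> 0")
      case True then show ?thesis using pos[of x "nat m"] by simp
    next
      case False then show ?thesis using pos[of "x + m * N" "nat (-m)"] by (simp add: algebra_simps)
    qed
  qed
  have dv: "N dvd f x - f y" if "\<And>x. f (x + N) = f x + N" "N dvd x - y" for f :: "int \<Rightarrow> int" and x y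
  proof -
    obtain m where m: "x - y = N * m" using \<open>N dvd x - y\<close> by (elim dvdE)
    then have "x = y + m * N" by (simp add: algebra_simps)
    then show ?thesis using add[of f y m, OF that(1)] by simp
  qed
  have "N dvd p x - p y \<longleftrightarrow> N dvd x - y" for x y
    using dv[of p, OF p(1)] dv[of q, OF p(2), of "p x" "p y"] p(4) by auto
  moreover have "range (c \<circ> p) = range c"
    using p(3) by (metis fun.set_map surj_def)
  ultimately show ?thesis using c by (auto simp: circles_def)
qed

text \<open>Composition with \<open>q\<close> undoes composition with \<open>p\<close>. The exchange
  of excess circles for deficit circles rests on this.\<close>

lemma sum_circles_comp:
  assumes "\<And>x. p (x + N) = p x + N" "\<And>x. q (x + N) = q x + N" "\<And>x. p (q x) = x" "\<And>x. q (p x) = x"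
  shows "(\<Sum>c\<in>circles N V. g (c \<circ> p)) = (\<Sum>c\<in>circles N V. g c)"
  by (rule sum.reindex_bij_witness[where i = "\<lambda>c. c \<circ> q" and j = "\<lambda>c. c \<circ> p"])
     (use assms circles_comp[of _ N V p q] circles_comp[of _ N V q p] in \<open>auto simp: o_def fun_eq_iff\<close>)

lemma sum_circles_rot: "(\<Sum>c\<in>circles N V. g (rot i c)) = (\<Sum>c\<in>circles N V. g c)"
  using sum_circles_comp[of "\<lambda>x. x + i" N "\<lambda>x. x - i" g V] by (simp add: rot_def o_def)

lemma rot_circles: "c \<in> circles N V \<Longrightarrow> rot i c \<in> circles N V"
  using circles_comp[of c N V "\<lambda>x. x + i" "\<lambda>x. x - i"] by (simp add: rot_def o_def)

text \<open>Extends a permutation of \<open>{0..<N}\<close> to the integers so that it commutes with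
  translation by \<open>N\<close>, as \<open>circles_comp\<close> requires.\<close>

definition lift_perm :: "int \<Rightarrow> (int \<Rightarrow> int) \<Rightarrow> int \<Rightarrow> int" where
  "lift_perm N f x = N * (x div N) + f (x mod N)"

lemma lift_perm_shift: "N > 0 \<Longrightarrow> lift_perm N f (x + N) = lift_perm N f x + N"
  by (simp add: lift_perm_def algebra_simps)

lemma lift_perm_inverse:
  assumes "N > 0" "\<And>x. x \<in> {0..<N} \<Longrightarrow> g x \<in> {0..<N} \<and> f (g x) = x"
  shows "lift_perm N f (lift_perm N g x) = x"
proof -
  have "x mod N \<in> {0..<N}" using assms by simp
  then have g: "g (x mod N) \<in> {0..<N}" "f (g (x mod N)) = x mod N" using assms(2) by blast+
  have "lift_perm N g x div N = x div N" "lift_perm N g x mod N = g (x mod N)"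
    using g(1) by (auto simp: lift_perm_def)
  then show ?thesis using g(2) by (simp add: lift_perm_def[of N f])
qed

lemma lift_perm_fundamental: "x \<in> {0..<N} \<Longrightarrow> lift_perm N f x = f x"
  by (simp add: lift_perm_def)

text \<open>A circle is determined by its values on one period.\<close>

lemma finite_circles:
  assumes "finite V" "N > 0"
  shows "finite (circles N V)"
proof (rule finite_imageD)
  let ?r = "\<lambda>c. restrict c {0..<N}"
  show "inj_on ?r (circles N V)"
  proof (rule inj_onI, rule ext)
    fix c d x assume cd: "c \<in> circles N V" "d \<in> circles N V" "?r c = ?r d"
    have "x mod N \<in> {0..<N}" using assms by simp
    then have "c (x mod N) = d (x mod N)" using cd(3) by (metis restrict_apply')
    moreover have "c (x mod N) = c x" "d (x mod N) = d x"
      using cd by (auto simp: circles_eq_iff mod_eq_dvd_iff[symmetric])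
    ultimately show "c x = d x" by simp
  qed
  have "?r ` circles N V \<subseteq> {0..<N} \<rightarrow>\<^sub>E V" by (auto simp: circles_def)
  then show "finite (?r ` circles N V)"
    by (rule finite_subset) (use assms in \<open>auto intro: finite_PiE\<close>)
qed

lemma circles_nonempty:
  assumes "finite V" "card V = n" "n > 0"
  shows "circles (int n) V \<noteq> {}"
proof -
  obtain f where f: "bij_betw f {0..<n} V" using assms ex_bij_betw_nat_finite by metis
  define c where "c x = f (nat (x mod int n))" for x
  have "c x = c y \<longleftrightarrow> int n dvd x - y" for x y
  proof -
    have "nat (x mod int n) \<in> {0..<n}" "nat (y mod int n) \<in> {0..<n}" using assms by (auto simp: nat_less_iff)
    then have "c x = c y \<longleftrightarrow> nat (x mod int n) = nat (y mod int n)"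
      unfolding c_def using f by (auto simp: bij_betw_def inj_on_def)
    also have "\<dots> \<longleftrightarrow> x mod int n = y mod int n" using assms by (auto simp: nat_eq_iff2)
    finally show ?thesis by (simp add: mod_eq_dvd_iff)
  qed
  moreover have "range c = V"
  proof
    show "range c \<subseteq> V"
    proof
      fix v assume "v \<in> range c"
      then obtain x where x: "v = f (nat (x mod int n))" by (auto simp: c_def)
      have "nat (x mod int n) \<in> {0..<n}" using assms by (auto simp: nat_less_iff)
      then show "v \<in> V" using f x by (auto simp: bij_betw_def)
    qed
    show "V \<subseteq> range c"
    proof
      fix v assume "v \<in> V"
      then obtain j where "j < n" "v = f j" using f by (auto simp: bij_betw_def)
      then have "v = c (int j)" by (simp add: c_def)
      then show "v \<in> range c" by simp
    qed
  qed
  ultimately show ?thesis by (auto simp: circles_def)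
qed

section \<open>Katona's averaging argument\<close>

lemma circles_postcomp:
  assumes "c \<in> circles N V" "bij_betw p V V"
  shows "p \<circ> c \<in> circles N V"
proof -
  have r: "range c = V" using assms by (simp add: circles_def)
  have "p (c x) = p (c y) \<longleftrightarrow> c x = c y" for x y
    using assms(2) r by (metis bij_betw_def inj_on_eq_iff rangeI)
  moreover have "range (p \<circ> c) = V" using assms(2) r by (metis bij_betw_def image_comp)
  ultimately show ?thesis using assms(1) by (auto simp: circles_def)
qed

text \<open>Relabelling by a permutation of \<open>V\<close> that carries \<open>X\<close> onto
  \<open>Y\<close> is injective on circles. Used in both directions, it shows that all sets of one
  size occur equally often as the arc at 0.\<close>

lemma card_circles_arc_le:
  assumes "finite V" "N > 0" "X \<subseteq> V" "Y \<subseteq> V" "card X = card Y"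
  shows "card {c\<in>circles N V. arc K c 0 = X} \<le> card {c\<in>circles N V. arc K c 0 = Y}"
proof -
  have fin: "finite X" "finite Y" using assms finite_subset by auto
  obtain f where f: "bij_betw f X Y" using fin assms(5) by (metis bij_betw_iff_card)
  have "card (V - X) = card (V - Y)" using assms fin by (simp add: card_Diff_subset)
  then obtain g where g: "bij_betw g (V - X) (V - Y)" using assms(1) by (metis bij_betw_iff_card finite_Diff)
  define p where "p x = (if x \<in> X then f x else g x)" for x
  have "bij_betw p X Y" using f by (subst bij_betw_cong[of _ p f]) (auto simp: p_def)
  moreover have "bij_betw p (V - X) (V - Y)" using g by (subst bij_betw_cong[of _ p g]) (auto simp: p_def)
  ultimately have "bij_betw p (X \<union> (V - X)) (Y \<union> (V - Y))" by (rule bij_betw_combine) auto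
  then have p: "bij_betw p V V" using assms by (simp add: Un_absorb1)
  have pX: "p ` X = Y" using \<open>bij_betw p X Y\<close> by (simp add: bij_betw_def)
  show ?thesis
  proof (rule card_inj_on_le)
    show "inj_on (\<lambda>c. p \<circ> c) {c\<in>circles N V. arc K c 0 = X}"
    proof (rule inj_onI, rule ext)
      fix c d x assume cd: "c \<in> {c\<in>circles N V. arc K c 0 = X}" "d \<in> {c\<in>circles N V. arc K c 0 = X}"
        and e: "p \<circ> c = p \<circ> d"
      have "c x \<in> V" "d x \<in> V" using cd unfolding circles_def by blast+
      moreover have "p (c x) = p (d x)" using e by (metis comp_apply)
      ultimately show "c x = d x" using p by (auto simp: bij_betw_def inj_on_def)
    qed
    show "(\<lambda>c. p \<circ> c) ` {c\<in>circles N V. arc K c 0 = X} \<subseteq> {c\<in>circles N V. arc K c 0 = Y}"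
    proof (rule image_subsetI)
      fix c assume c: "c \<in> {c\<in>circles N V. arc K c 0 = X}"
      then have "p \<circ> c \<in> circles N V" using circles_postcomp p by blast
      moreover have "arc K (p \<circ> c) 0 = p ` X" using c by (auto simp: arc_def image_comp)
      ultimately show "p \<circ> c \<in> {c\<in>circles N V. arc K c 0 = Y}" using pX by simp
    qed
    show "finite {c\<in>circles N V. arc K c 0 = Y}" using finite_circles[OF assms(1,2)] by simp
  qed
qed

text \<open>Double counting of circles and places: after a rotation every place contributes
  \<open>card Fam\<close> times a constant \<open>m X0\<close>, and the number of circles is
  \<open>n choose k\<close> times the same constant.\<close>

lemma katona_average:
  fixes V :: "'a set"
  assumes V: "finite V" "card V = n" and k: "0 < k" "k < n"
    and Fam: "Fam \<subseteq> {A. A \<subseteq> V \<and> card A = k}"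
    and le: "(\<Sum>c\<in>circles (int n) V. \<Sum>s\<in>{0..<int n}. of_bool (arc (int k) c s \<in> Fam))
       \<le> int k * int (card (circles (int n) V))"
  shows "card Fam \<le> (n - 1) choose (k - 1)"
proof -
  let ?C = "circles (int n) V"
  let ?U = "{A. A \<subseteq> V \<and> card A = k}"
  have finC: "finite ?C" using finite_circles[OF V(1), of "int n"] k by auto
  have finU: "finite ?U" using V by simp
  define m where "m X = card {c\<in>?C. arc (int k) c 0 = X}" for X
  obtain X0 where X0: "X0 \<in> ?U" using V k by (metis (mono_tags) mem_Collect_eq obtain_subset_with_card_n less_imp_le)
  have meq: "m X = m X0" if "X \<in> ?U" for X
    unfolding m_def using card_circles_arc_le[of V "int n" X X0 "int k"]
      card_circles_arc_le[of V "int n" X0 X "int k"] that X0 V k by (intro antisym) auto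
  have in_U: "arc (int k) c 0 \<in> ?U" if "c \<in> ?C" for c
    using arc_subset[OF that, of "int k" 0] card_arc[OF that, of "int k" 0] k by auto
  have count: "card {c\<in>?C. arc (int k) c 0 \<in> T} = card T * m X0" if "T \<subseteq> ?U" for T
  proof -
    have "finite T" using that finU finite_subset by blast
    have "{c\<in>?C. arc (int k) c 0 \<in> T} = (\<Union>X\<in>T. {c\<in>?C. arc (int k) c 0 = X})" by auto
    then have "card {c\<in>?C. arc (int k) c 0 \<in> T} = (\<Sum>X\<in>T. m X)"
      unfolding m_def using finC \<open>finite T\<close> by (simp only:) (rule card_UN_disjoint, auto)
    also have "\<dots> = (\<Sum>X\<in>T. m X0)" using that meq by (intro sum.cong) auto
    finally show ?thesis by simp
  qed
  have "{c\<in>?C. arc (int k) c 0 \<in> ?U} = ?C" using in_U by blast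
  then have cC: "card ?C = (n choose k) * m X0"
    using count[of ?U] n_subsets[OF V(1), of k] V by simp
  have "card ?C > 0" using circles_nonempty V k finC by (metis card_gt_0_iff less_trans)
  then have m0: "m X0 > 0" using cC by auto
  have "(\<Sum>c\<in>?C. \<Sum>s\<in>{0..<int n}. of_bool (arc (int k) c s \<in> Fam))
      = (\<Sum>s\<in>{0..<int n}. \<Sum>c\<in>?C. of_bool (arc (int k) c s \<in> Fam) :: int)" by (rule sum.swap)
  also have "\<dots> = (\<Sum>s\<in>{0..<int n}. int (card {c\<in>?C. arc (int k) c 0 \<in> Fam}))"
  proof (rule sum.cong)
    fix s
    have "(\<Sum>c\<in>?C. of_bool (arc (int k) c s \<in> Fam) :: int) = (\<Sum>c\<in>?C. of_bool (arc (int k) (rot s c) 0 \<in> Fam))"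
      by (simp add: arc_rot)
    also have "\<dots> = (\<Sum>c\<in>?C. of_bool (arc (int k) c 0 \<in> Fam))" by (rule sum_circles_rot)
    also have "\<dots> = int (card {c\<in>?C. arc (int k) c 0 \<in> Fam})" using finC by (simp add: Int_def)
    finally show "(\<Sum>c\<in>?C. of_bool (arc (int k) c s \<in> Fam) :: int) = int (card {c\<in>?C. arc (int k) c 0 \<in> Fam})" .
  qed simp
  also have "\<dots> = int (n * (card Fam * m X0))" using count[OF Fam] by simp
  finally have "int (n * (card Fam * m X0)) \<le> int (k * ((n choose k) * m X0))"
    using le cC by simp
  then have "n * card Fam * m X0 \<le> k * (n choose k) * m X0" by (simp only: of_nat_le_iff mult.assoc)
  then have "n * card Fam \<le> k * (n choose k)" using m0 by simp
  also have "k * (n choose k) = n * ((n - 1) choose (k - 1))"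
    using times_binomial_minus1_eq[of k n] k by simp
  finally show ?thesis using k by simp
qed

section \<open>Excess and deficit circles\<close>

text \<open>Positions of a circle read as \<open>f\<^sub>1\<dots>f\<^bsub>k-1\<^esub> a f\<^sub>k g\<^sub>1 b g\<^sub>2\<dots>g\<^sub>k \<dots>\<close> are
  visited in the order \<open>f\<^sub>1\<dots>f\<^sub>k g\<^sub>1\<dots>g\<^sub>k a b \<dots>\<close>.\<close>

definition gap_insert :: "int \<Rightarrow> int \<Rightarrow> int" where
  "gap_insert K y = (if y < K - 1 then y else if y < K + 1 then y + 1 else if y < 2 * K then y + 2
     else if y = 2 * K then K - 1 else if y = 2 * K + 1 then K + 2 else y)"

definition gap_remove :: "int \<Rightarrow> int \<Rightarrow> int" where
  "gap_remove K y = (if y < K - 1 then y else if y = K - 1 then 2 * K else if y < K + 2 then y - 1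
     else if y = K + 2 then 2 * K + 1 else if y < 2 * K + 2 then y - 2 else y)"

text \<open>Each of the two transpositions destroys one of the \<open>k + 1\<close> alternating
  arcs, so that \<open>k - 1\<close> remain.\<close>

definition swap2 :: "int \<Rightarrow> int" where
  "swap2 y = (if y = 1 then 2 else if y = 2 then 1 else if y = 3 then 4 else if y = 4 then 3 else y)"

text \<open>Only the union of the families is kept; \<open>trans\<close> retains which members
  belong together.\<close>

locale cluster_family =
  fixes V :: "'a set" and n k :: nat and Fam :: "'a set set"
  assumes V: "finite V" "card V = n" and k: "4 \<le> k" and n: "2 * k + 2 \<le> n"
    and Fam: "Fam \<subseteq> {A. A \<subseteq> V \<and> card A = k}"
    and trans: "\<lbrakk>X \<in> Fam; Y \<in> Fam; Z \<in> Fam; X \<inter> Y = {}; Y \<inter> Z = {}\<rbrakk> \<Longrightarrow> X = Z \<or> X \<inter> Z = {}"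
    and clique: "\<lbrakk>S \<subseteq> Fam; \<And>X Y. X \<in> S \<Longrightarrow> Y \<in> S \<Longrightarrow> X \<noteq> Y \<Longrightarrow> X \<inter> Y = {}\<rbrakk> \<Longrightarrow> card S \<le> k"
begin

abbreviation "N \<equiv> int n"
abbreviation "K \<equiv> int k"
abbreviation "C \<equiv> circles N V"
abbreviation "ar \<equiv> arc K"

section \<open>Arc counts of the circles over \<open>V\<close>\<close>

lemma KN: "4 \<le> K" "2 * K + 2 \<le> N" using k n by auto

definition arc_cnt :: "(int \<Rightarrow> 'a) \<Rightarrow> int" where
  "arc_cnt c = (\<Sum>s\<in>{0..<N}. of_bool (ar c s \<in> Fam))"

lemma arc_cluster: assumes c: "c \<in> C" shows "arc_cluster N K (\<lambda>s. ar c s \<in> Fam)"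
proof
  show "4 \<le> K" "2 * K + 2 \<le> N" by (fact KN)+
  show "ar c (x + N) \<in> Fam \<longleftrightarrow> ar c x \<in> Fam" for x using arc_periodic[OF c, of "x + N" x K] by simp
  have dj: "arcs_disjoint N K s t \<longleftrightarrow> ar c s \<inter> ar c t = {}" for s t
    using arc_disjoint_iff[OF c] KN by simp
  show "N dvd u - s \<or> arcs_disjoint N K s u"
    if "ar c s \<in> Fam" "ar c t \<in> Fam" "ar c u \<in> Fam" "arcs_disjoint N K s t" "arcs_disjoint N K t u" for s t u
    using trans[OF that(1-3)] that(4,5) arc_inj[OF c, of K s u] KN unfolding dj by auto
  show "int (card S) \<le> K" if S: "S \<subseteq> {0..<N}" "\<And>s. s \<in> S \<Longrightarrow> ar c s \<in> Fam"
    "\<And>s t. s \<in> S \<Longrightarrow> t \<in> S \<Longrightarrow> s \<noteq> t \<Longrightarrow> arcs_disjoint N K s t" for S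
  proof -
    have "inj_on (ar c) S"
    proof (rule inj_onI)
      fix s t assume st: "s \<in> S" "t \<in> S" "ar c s = ar c t"
      then have "N dvd t - s" using arc_inj[OF c, of K s t] KN by simp
      moreover have "s \<in> {0..<N}" "t \<in> {0..<N}" using st S(1) by auto
      then have "\<bar>t - s\<bar> < N" by auto
      ultimately show "s = t" using int_dvd_small by fastforce
    qed
    then have "card S = card (ar c ` S)" by (simp add: card_image)
    also have "\<dots> \<le> k"
    proof (rule clique)
      fix X Y assume "X \<in> ar c ` S" "Y \<in> ar c ` S" "X \<noteq> Y"
      then obtain s t where "s \<in> S" "t \<in> S" "X = ar c s" "Y = ar c t" "s \<noteq> t" by auto
      then show "X \<inter> Y = {}" using S(3)[of s t] dj by auto
    qed (use S in auto)
    finally show ?thesis by simp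
  qed
qed

lemma arc_cnt_eq: "c \<in> C \<Longrightarrow> arc_cluster.arc_count N (\<lambda>s. ar c s \<in> Fam) = arc_cnt c"
  by (simp add: arc_cluster.arc_count_def[OF arc_cluster] arc_cnt_def)

text \<open>For \<open>n = 2 * k + 2\<close> a circle with \<open>k + 1\<close> arcs need not consist of a single run of consecutive
  arcs, but these four positions are always occupied.\<close>

definition run_pos :: "int set" where
  "run_pos = (if n = 2 * k + 2 then {0, 1, K - 1, K} else {0..K})"

definition run :: "(int \<Rightarrow> 'a) \<Rightarrow> bool" where "run c \<longleftrightarrow> (\<forall>j\<in>run_pos. ar c j \<in> Fam)"

text \<open>The other extremal configuration: every second arc, matched up in opposite pairs.\<close>

definition alt :: "(int \<Rightarrow> 'a) \<Rightarrow> bool" where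
  "alt c \<longleftrightarrow> n = 2 * k + 2 \<and> odd k \<and> (\<forall>s. ar c s \<in> Fam \<longleftrightarrow> even s)"

text \<open>Combines both ranges of \<open>n\<close>, rotating a run to place 0 and an alternating
  configuration to even places.\<close>

lemma arc_cnt_excess:
  assumes c: "c \<in> C"
  shows "arc_cnt c \<le> K \<or> arc_cnt c = K + 1 \<and> ((\<exists>i\<in>{0..<N}. run (rot i c)) \<or> alt c \<or> alt (rot 1 c))"
proof -
  interpret A: arc_cluster N K "\<lambda>s. ar c s \<in> Fam" by (rule arc_cluster[OF c])
  have runI: "\<exists>i\<in>{0..<N}. run (rot i c)" if "\<forall>j\<in>run_pos. ar c (i + j) \<in> Fam" for i
  proof
    show "i mod N \<in> {0..<N}" using KN by simp
    have "ar c (j + i mod N) = ar c (i + j)" for j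
      by (rule arc_periodic[OF c]) (simp add: mod_simps add.commute)
    then show "run (rot (i mod N) c)" using that by (simp add: run_def arc_rot)
  qed
  show ?thesis
  proof (cases "n = 2 * k + 2")
    case True
    then have NN: "N = 2 * K + 2" by simp
    show ?thesis
    proof (cases "arc_cnt c = K + 1")
      case False
      then show ?thesis using A.arc_count_tight[OF NN] arc_cnt_eq[OF c] by simp
    next
      case eq: True
      then have "A.arc_count = K + 1" using arc_cnt_eq[OF c] by simp
      from A.arc_count_tight_eq[OF NN this]
      have "(\<exists>i\<in>{0..<N}. run (rot i c)) \<or> alt c \<or> alt (rot 1 c)"
      proof
        assume "\<exists>i. ar c i \<in> Fam \<and> ar c (i + 1) \<in> Fam \<and> ar c (i + (K - 1)) \<in> Fam \<and> ar c (i + K) \<in> Fam"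
        then obtain i where "\<forall>j\<in>{0, 1, K - 1, K}. ar c (i + j) \<in> Fam" by auto
        moreover have "run_pos = {0, 1, K - 1, K}" unfolding run_pos_def using True by simp
        ultimately show ?thesis using runI[of i] by simp
      next
        assume "odd K \<and> (\<exists>e\<in>{0,1}. \<forall>s. (ar c s \<in> Fam) = even (s - e))"
        then show ?thesis unfolding alt_def arc_rot using True by auto
      qed
      then show ?thesis using eq by blast
    qed
  next
    case False
    then have NN: "2 * K + 3 \<le> N" using n by simp
    have rp: "run_pos = {0..K}" using False by (simp add: run_pos_def)
    show ?thesis using A.arc_count_wide[OF NN] runI unfolding rp arc_cnt_eq[OF c] by blast
  qed
qed

section \<open>Circles obtained from a run by moving two points\<close>

abbreviation spread :: "int \<Rightarrow> int" where "spread \<equiv> lift_perm N (gap_insert K)"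
abbreviation spread' :: "int \<Rightarrow> int" where "spread' \<equiv> lift_perm N (gap_remove K)"

lemma spread_inverse: "spread (spread' x) = x" "spread' (spread x) = x"
  by (rule lift_perm_inverse; use KN in \<open>auto simp: gap_insert_def gap_remove_def split: if_splits\<close>)+

text \<open>Here \<open>c\<close> is the circle after the move; composing with \<open>spread\<close>
  recovers the one before it.\<close>

definition spread_run :: "(int \<Rightarrow> 'a) \<Rightarrow> bool" where "spread_run c \<longleftrightarrow> run (c \<circ> spread)"

text \<open>The positions, in a circle satisfying \<open>spread_run\<close>, of the arcs \<open>0\<close>, \<open>1\<close>, \<open>k - 1\<close>, \<open>k\<close> of the
  corresponding circle satisfying \<open>run\<close>.\<close>

definition T0 where "T0 = {0..K - 2} \<union> {K}"
definition T1 where "T1 = {1..K - 2} \<union> {K, K + 1}"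
definition T2 where "T2 = {K, K + 1} \<union> {K + 3..2 * K}"
definition T3 where "T3 = {K + 1} \<union> {K + 3..2 * K + 1}"

lemma arc_spread:
  assumes "0 \<le> j" "j \<le> K"
  shows "ar (c \<circ> spread) j = c ` gap_insert K ` {j..<j + K}"
proof -
  have "spread ` {j..<j + K} = gap_insert K ` {j..<j + K}"
    by (rule image_cong) (use assms KN in \<open>auto intro!: lift_perm_fundamental\<close>)
  then show ?thesis unfolding arc_def image_comp[symmetric] by simp
qed

lemma gap_images:
  "gap_insert K ` {0..<0 + K} = T0" "gap_insert K ` {1..<1 + K} = T1"
  "gap_insert K ` {K - 1..<K - 1 + K} = T2" "gap_insert K ` {K..<K + K} = T3"
proof -
  have gr: "gap_insert K (gap_remove K y) = y" if "0 \<le> y" "y \<le> 2 * K + 1" for y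
    using that KN by (auto simp: gap_insert_def gap_remove_def)
  have eq: "gap_insert K ` A = B"
    if "\<And>x. x \<in> A \<Longrightarrow> gap_insert K x \<in> B" "\<And>y. y \<in> B \<Longrightarrow> gap_remove K y \<in> A" "B \<subseteq> {0..2 * K + 1}" for A B
  proof
    show "gap_insert K ` A \<subseteq> B" using that by auto
    show "B \<subseteq> gap_insert K ` A"
    proof
      fix y assume y: "y \<in> B"
      then have "y = gap_insert K (gap_remove K y)" using gr[of y] that(3) by auto
      then show "y \<in> gap_insert K ` A" using that(2)[OF y] by blast
    qed
  qed
  show "gap_insert K ` {0..<0 + K} = T0" "gap_insert K ` {1..<1 + K} = T1"
  "gap_insert K ` {K - 1..<K - 1 + K} = T2" "gap_insert K ` {K..<K + K} = T3"
    by (rule eq; use KN in \<open>auto simp: gap_insert_def gap_remove_def T0_def T1_def T2_def T3_def\<close>)+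
qed

lemma spread_run_mem:
  assumes "spread_run c"
  shows "c ` T0 \<in> Fam" "c ` T1 \<in> Fam" "c ` T2 \<in> Fam" "c ` T3 \<in> Fam"
proof -
  have "{0, 1, K - 1, K} \<subseteq> run_pos" using KN by (auto simp: run_pos_def)
  then have r: "ar (c \<circ> spread) j \<in> Fam" if "j \<in> {0, 1, K - 1, K}" for j
    using that assms unfolding spread_run_def run_def by blast
  show "c ` T0 \<in> Fam" using r[of 0] arc_spread[of 0 c] gap_images(1) by simp
  show "c ` T1 \<in> Fam" using r[of 1] arc_spread[of 1 c] gap_images(2) KN by simp
  show "c ` T2 \<in> Fam" using r[of "K - 1"] arc_spread[of "K - 1" c] gap_images(3) KN by simp
  show "c ` T3 \<in> Fam" using r[of K] arc_spread[of K c] gap_images(4) KN by simp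
qed

lemma T_bounds: "T0 \<subseteq> {0..K}" "T1 \<subseteq> {1..K+1}" "T2 \<subseteq> {K..2*K}" "T3 \<subseteq> {K+1..2*K+1}"
  using KN by (auto simp: T0_def T1_def T2_def T3_def)

lemma shift_bounds: "T \<subseteq> {a..b} \<Longrightarrow> (\<lambda>x. x + i) ` T \<subseteq> {a + i..b + i :: int}"
  by auto

lemma arc_bounds: "{s..<s + K} \<subseteq> {s..s + K - 1}"
  by auto

lemma disj_T03: "c \<in> C \<Longrightarrow> c ` T0 \<inter> c ` T3 = {}"
  by (rule circles_image_disjoint[OF _ T_bounds(1,4)]) (use KN in auto)

text \<open>The pair \<open>T0\<close>, \<open>T3\<close> is a full clique, since \<open>T1\<close> lies in its union and meets both of its sets.\<close>
lemma spread_run_partner: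
  assumes c: "c \<in> C" and l: "spread_run c" and X: "X \<in> Fam"
  shows "X \<inter> c ` T0 = {} \<Longrightarrow> X = c ` T3" "X \<inter> c ` T3 = {} \<Longrightarrow> X = c ` T0"
proof -
  note m = spread_run_mem[OF l]
  have sub: "c ` T1 \<subseteq> c ` T0 \<union> c ` T3" using KN by (auto simp: T0_def T1_def T3_def)
  have "c K \<in> c ` T0 \<inter> c ` T1" by (auto simp: T0_def T1_def)
  moreover have "c (K + 1) \<in> c ` T3 \<inter> c ` T1" by (auto simp: T3_def T1_def)
  ultimately have no: "c ` T1 \<inter> c ` T0 \<noteq> {}" "c ` T1 \<inter> c ` T3 \<noteq> {}" by auto
  have ne: "c ` T1 \<noteq> c ` T0" "c ` T1 \<noteq> c ` T3" using no disj_T03[OF c] by (metis inf_commute)+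
  have both: False if "X \<inter> c ` T0 = {}" "X \<inter> c ` T3 = {}"
  proof -
    have "X \<inter> c ` T1 \<subseteq> X \<inter> (c ` T0 \<union> c ` T3)" using sub by (rule Int_mono[OF order_refl])
    also have "\<dots> = {}" unfolding Int_Un_distrib that by simp
    finally have "c ` T1 \<inter> X = {}" by (simp only: inf_commute subset_empty)
    then show False using trans[OF m(2) X m(1) _ that(1)] no(1) ne(1) by satx
  qed
  show "X = c ` T3" if "X \<inter> c ` T0 = {}"
    using trans[OF X m(1) m(4) that disj_T03[OF c]] both[OF that] by satx
  show "X = c ` T0" if "X \<inter> c ` T3 = {}"
    using trans[OF X m(4) m(1) that] disj_T03[OF c, unfolded inf_commute[of "c ` T0"]] both[OF _ that] by satx
qed

text \<open>Neither \<open>c\<close> followed by \<open>T0\<close> nor by \<open>T3\<close> is an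
  arc, as \<open>K\<close> is isolated in \<open>T0\<close> and \<open>K + 1\<close> in
  \<open>T3\<close>. By \<open>spread_run_partner\<close> every member arc therefore meets both
  images, which restricts its start.\<close>

lemma spread_run_range:
  assumes c: "c \<in> C" and l: "spread_run c" and s: "0 \<le> s" "s < N" "ar c s \<in> Fam"
  shows "s \<in> {2..K} \<union> {N-K+1..2*K+1}"
proof (rule ccontr)
  assume no: "\<not> ?thesis"
  have mem: "c x \<in> c ` T \<longleftrightarrow> x \<in> T" if "T \<subseteq> {0..<N}" "x \<in> {0..<N}" for x T
    using circles_mem_image[OF c, of T 0 x] that by simp
  have b: "T0 \<subseteq> {0..<N}" "T3 \<subseteq> {0..<N}" using T_bounds KN by auto
  have "ar c s \<noteq> c ` T0"
  proof
    assume e: "ar c s = c ` T0"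
    have "c K \<in> ar c s" unfolding e by (simp add: T0_def)
    then have "c (K - 1) \<in> c ` T0 \<or> c (K + 1) \<in> c ` T0"
      using arc_connected[OF c _ , of K K s] KN e by auto
    then show False using mem[OF b(1)] KN by (auto simp: T0_def)
  qed
  then have m3: "ar c s \<inter> c ` T3 \<noteq> {}" using spread_run_partner(2)[OF c l s(3)] by auto
  have "ar c s \<noteq> c ` T3"
  proof
    assume e: "ar c s = c ` T3"
    have "c (K + 1) \<in> ar c s" unfolding e by (simp add: T3_def)
    then have "c (K + 1 - 1) \<in> c ` T3 \<or> c (K + 1 + 1) \<in> c ` T3"
      using arc_connected[OF c _ , of K "K + 1" s] KN e by auto
    then show False using mem[OF b(2)] KN by (auto simp: T3_def)
  qed
  then have m0: "ar c s \<inter> c ` T0 \<noteq> {}" using spread_run_partner(1)[OF c l s(3)] by auto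
  consider "s \<le> 1" | "s \<in> {K+1..N-K}" | "s \<ge> 2 * K + 2" using no by fastforce
  then show False
  proof cases
    case 1
    have "ar c s \<inter> c ` T3 = {}" unfolding arc_def
      by (rule circles_image_disjoint[OF c arc_bounds T_bounds(4)]) (use 1 s KN in auto)
    then show False using m3 by simp
  next
    case 2
    have "c ` T0 \<inter> ar c s = {}" unfolding arc_def
      by (rule circles_image_disjoint[OF c T_bounds(1) arc_bounds]) (use 2 KN in auto)
    then show False using m0 by auto
  next
    case 3
    have "c ` T3 \<inter> ar c s = {}" unfolding arc_def
      by (rule circles_image_disjoint[OF c T_bounds(4) arc_bounds]) (use 3 s KN in auto)
    then show False using m3 by auto
  qed
qed

section \<open>Which rotations can be spread runs simultaneously\<close>

lemma rot_image: "rot i c ` T = c ` (\<lambda>x. x + i) ` T"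
  by (simp add: rot_def image_image)

lemma rot_rot: "rot i (rot j c) = rot (i + j) c"
  by (simp add: rot_def add.assoc)

lemma rot_N: "c \<in> C \<Longrightarrow> rot (i + N) c = rot i c"
  unfolding rot_def by (metis add.assoc circles_periodic)

text \<open>The shifted \<open>T0\<close> is disjoint from \<open>T0\<close>, so its image must be
  that of \<open>T3\<close>; but their gaps are in different places.\<close>

lemma spread_run_incompatible_far:
  assumes c: "c \<in> C" and l: "spread_run c" "spread_run (rot i c)" and i: "K + 1 \<le> i" "i + K < N"
  shows False
proof -
  have "rot i c ` T0 \<in> Fam" using spread_run_mem[OF l(2)] by blast
  moreover have "c ` T0 \<inter> rot i c ` T0 = {}" unfolding rot_image
    by (rule circles_image_disjoint[OF c T_bounds(1) shift_bounds[OF T_bounds(1)]]) (use i KN in auto)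
  then have "rot i c ` T0 \<inter> c ` T0 = {}" by (simp only: inf_commute)
  ultimately have "rot i c ` T0 = c ` T3" by (rule spread_run_partner(1)[OF c l(1)])
  then have e: "c ` (\<lambda>x. x + i) ` T0 = c ` T3" by (simp only: rot_image)
  have mem: "c x \<in> c ` T \<longleftrightarrow> x \<in> T" if "T \<subseteq> {0..<N}" "x \<in> {0..<N}" for x T
    using circles_mem_image[OF c, of T 0 x] that by simp
  have b: "T3 \<subseteq> {0..<N}" "(\<lambda>x. x + i) ` T0 \<subseteq> {0..<N}"
    by (rule subset_trans[OF T_bounds(4)] subset_trans[OF shift_bounds[OF T_bounds(1)]]; use KN i in auto)+
  show False
  proof (cases "i = K + 1")
    case True
    have "1 \<in> T0" using KN by (auto simp: T0_def)
    then have "c (1 + i) \<in> c ` (\<lambda>x. x + i) ` T0" by (intro imageI)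
    then have "c (1 + i) \<in> c ` T3" by (simp only: e)
    moreover have "1 + i = K + 2" using True by simp
    ultimately have "c (K + 2) \<in> c ` T3" by (simp only:)
    then show False using mem[OF b(1), of "K + 2"] KN by (auto simp: T3_def)
  next
    case False
    have "c (K + 1) \<in> c ` (\<lambda>x. x + i) ` T0" unfolding e by (auto simp: T3_def)
    then have "K + 1 \<in> (\<lambda>x. x + i) ` T0" by (subst (asm) mem[OF b(2)]) (use KN in auto)
    then show False using False i KN by (auto simp: T0_def)
  qed
qed

text \<open>Arc \<open>i - 1\<close> of the first run is disjoint from the shifted
  \<open>T3\<close>, so it must coincide with the shifted \<open>T0\<close>. The place
  \<open>i - 1\<close>, or \<open>K + 2\<close> when \<open>i = K\<close>, tells them apart.\<close>

lemma spread_run_incompatible_near: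
  assumes NN: "N > 2 * K + 2" and c: "c \<in> C" and l: "spread_run c" "spread_run (rot i c)" and i: "1 \<le> i" "i \<le> K"
  shows False
proof -
  define T where "T = gap_insert K ` {i - 1..<i - 1 + K}"
  have r: "rot i c \<in> C" using c by (rule rot_circles)
  have "run_pos = {0..K}" using NN by (simp add: run_pos_def)
  then have "ar (c \<circ> spread) (i - 1) \<in> Fam" using l(1) i by (auto simp: spread_run_def run_def)
  then have T: "c ` T \<in> Fam" using arc_spread[of "i - 1" c] i by (simp add: T_def)
  have Tb: "T \<subseteq> {i - 1..i + K}" using i KN by (auto simp: T_def gap_insert_def)
  have Tn: "K + 2 \<notin> T" using i KN by (auto simp: T_def gap_insert_def split: if_splits)
  have "c ` T \<inter> rot i c ` T3 = {}" unfolding rot_image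
    by (rule circles_image_disjoint[OF c Tb shift_bounds[OF T_bounds(4)]]) (use i KN NN in auto)
  then have "c ` T = rot i c ` T0" by (rule spread_run_partner(2)[OF r l(2) T])
  then have e: "c ` T = c ` (\<lambda>x. x + i) ` T0" by (simp add: rot_image)
  have mem: "c x \<in> c ` T \<longleftrightarrow> x \<in> T" if "T \<subseteq> {0..<N}" "x \<in> {0..<N}" for x T
    using circles_mem_image[OF c, of T 0 x] that by simp
  have b: "T \<subseteq> {0..<N}" "(\<lambda>x. x + i) ` T0 \<subseteq> {0..<N}"
    by (rule subset_trans[OF Tb] subset_trans[OF shift_bounds[OF T_bounds(1)]]; use KN i in auto)+
  show False
  proof (cases "i = K")
    case True
    have "2 \<in> T0" using KN by (auto simp: T0_def)
    then have "c (2 + i) \<in> c ` (\<lambda>x. x + i) ` T0" by (intro imageI)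
    then have "c (2 + i) \<in> c ` T" by (simp only: e)
    moreover have "2 + i = K + 2" using True by simp
    ultimately have "c (K + 2) \<in> c ` T" by (simp only:)
    then show False using mem[OF b(1), of "K + 2"] KN Tn by auto
  next
    case False
    then have "gap_insert K (i - 1) = i - 1" using i by (simp add: gap_insert_def)
    then have "i - 1 \<in> T" using KN unfolding T_def by (metis atLeastLessThan_iff image_eqI order_refl
          less_add_same_cancel1 zero_less_numeral order_less_le_trans)
    then have "c (i - 1) \<in> c ` (\<lambda>x. x + i) ` T0" unfolding e[symmetric] by (rule imageI)
    then have "i - 1 \<in> (\<lambda>x. x + i) ` T0" by (subst (asm) mem[OF b(2)]) (use KN i in auto)
    then show False using T_bounds(1) by auto
  qed
qed

text \<open>\<open>T1\<close> is disjoint from the shifted \<open>T3\<close> or \<open>T0\<close>,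
  so it must be the other one; that set covers the place \<open>K - 1\<close> of the moved point,
  which \<open>T1\<close> omits.\<close>

lemma spread_run_incompatible_tight:
  assumes NN: "N = 2 * K + 2" and c: "c \<in> C" and l: "spread_run c"
  shows "\<not> spread_run (rot 1 c)" "\<not> spread_run (rot (K + 2) c)"
proof -
  have T1: "c ` T1 \<in> Fam" using spread_run_mem[OF l] by blast
  have mem: "c x \<in> c ` T \<longleftrightarrow> x \<in> T" if "T \<subseteq> {0..<N}" "x \<in> {0..<N}" for x T
    using circles_mem_image[OF c, of T 0 x] that by simp
  have b: "T1 \<subseteq> {0..<N}" by (rule subset_trans[OF T_bounds(2)]) (use KN in auto)
  have k1: "c (K - 1) \<notin> c ` T1" using mem[OF b, of "K - 1"] KN by (auto simp: T1_def)
  have r: "rot i c \<in> C" for i using c by (rule rot_circles)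
  show "\<not> spread_run (rot 1 c)"
  proof
    assume l1: "spread_run (rot 1 c)"
    have "c ` T1 \<inter> rot 1 c ` T3 = {}" unfolding rot_image
      by (rule circles_image_disjoint[OF c T_bounds(2) shift_bounds[OF T_bounds(4)]]) (use KN NN in auto)
    then have "c ` T1 = rot 1 c ` T0" by (rule spread_run_partner(2)[OF r l1 T1])
    moreover have "rot 1 c (K - 2) = c (K - 1)" by (simp add: rot_def)
    moreover have "K - 2 \<in> T0" using KN by (auto simp: T0_def)
    ultimately show False using k1 by (metis image_eqI)
  qed
  show "\<not> spread_run (rot (K + 2) c)"
  proof
    assume l1: "spread_run (rot (K + 2) c)"
    have "c ` T1 \<inter> rot (K + 2) c ` T0 = {}" unfolding rot_image
      by (rule circles_image_disjoint[OF c T_bounds(2) shift_bounds[OF T_bounds(1)]]) (use KN NN in auto)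
    then have "c ` T1 = rot (K + 2) c ` T3" by (rule spread_run_partner(1)[OF r l1 T1])
    moreover have "rot (K + 2) c (2 * K - 1) = c (K - 1)"
      using circles_periodic[OF c, of "K - 1"] NN by (simp add: rot_def algebra_simps)
    moreover have "2 * K - 1 \<in> T3" using KN by (auto simp: T3_def)
    ultimately show False using k1 by (metis image_eqI)
  qed
qed

text \<open>Supplies the column conditions of \<open>arc_count_tight_deficit\<close>. For the last
  one, the arc at \<open>K\<close> and the image of \<open>T2\<close> overlap and are both disjoint
  from the arc at \<open>-1\<close>, but only the former contains \<open>c (K + 2)\<close>.\<close>

lemma spread_run_col:
  assumes NN: "N = 2 * K + 2" and c: "c \<in> C" and l: "spread_run c"
  shows "ar c 0 \<notin> Fam" "ar c (K + 1) \<notin> Fam" "ar c 1 \<notin> Fam" "ar c (K + 2) \<notin> Fam"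
    "\<not> (ar c (-1) \<in> Fam \<and> ar c K \<in> Fam)"
proof -
  show "ar c 0 \<notin> Fam" using spread_run_range[OF c l, of 0] KN NN by auto
  show "ar c (K+1) \<notin> Fam" using spread_run_range[OF c l, of "K+1"] KN NN by auto
  show "ar c 1 \<notin> Fam" using spread_run_range[OF c l, of 1] KN NN by auto
  show "ar c (K+2) \<notin> Fam" using spread_run_range[OF c l, of "K+2"] KN NN by auto
  show "\<not> (ar c (-1) \<in> Fam \<and> ar c K \<in> Fam)"
  proof
    assume a: "ar c (-1) \<in> Fam \<and> ar c K \<in> Fam"
    have m: "c ` T2 \<in> Fam" using spread_run_mem[OF l] by blast
    have "ar c (-1) \<inter> c ` T2 = {}" unfolding arc_def
      by (rule circles_image_disjoint[OF c arc_bounds T_bounds(3)]) (use KN NN in auto)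
    moreover have "ar c (-1) \<inter> ar c K = {}" unfolding arc_def
      by (rule circles_image_disjoint[OF c arc_bounds arc_bounds]) (use KN NN in auto)
    ultimately have "ar c K = c ` T2 \<or> ar c K \<inter> c ` T2 = {}"
      using trans[of "ar c K" "ar c (-1)" "c ` T2"] a m by auto
    moreover have "c K \<in> ar c K \<inter> c ` T2" using KN by (auto simp: T2_def arc_def)
    ultimately have e: "ar c K = c ` T2" by auto
    have "c (K + 2) \<in> ar c K" using KN by (auto simp: arc_def)
    then have "c (K + 2) \<in> c ` T2" using e by simp
    moreover have "T2 \<subseteq> {0..<0 + N}" "K + 2 \<in> {0..<0 + N}" using T_bounds KN by auto
    ultimately have "K + 2 \<in> T2" using circles_mem_image[OF c] by metis
    then show False using KN by (auto simp: T2_def)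
  qed
qed

section \<open>The deficit caused by spread runs\<close>

definition spread_run_cnt :: "(int \<Rightarrow> 'a) \<Rightarrow> int" where
  "spread_run_cnt c = (\<Sum>i\<in>{0..<N}. of_bool (spread_run (rot i c)))"

lemma arc_cnt_rot: assumes "c \<in> C" shows "arc_cnt (rot i c) = arc_cnt c"
  unfolding arc_cnt_def arc_rot
  by (rule sum_periodic_shift[where g = "\<lambda>s. of_bool (ar c s \<in> Fam)"])
     (use KN arc_periodic[OF assms, of "_ + N" _ K] in simp_all)

text \<open>For \<open>N = 2 * K + 2\<close> each spread run costs two arcs, starting from
  \<open>K + 1\<close>. For larger \<open>N\<close> only one rotation can be a spread run, and at
  most \<open>K - 1\<close> arcs remain.\<close>

lemma spread_run_cnt_deficit:
  assumes c: "c \<in> C" and pos: "spread_run_cnt c > 0"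
  shows "arc_cnt c + spread_run_cnt c \<le> K"
proof (cases "N = 2 * K + 2")
  case NN: True
  interpret A: arc_cluster N K "\<lambda>s. ar c s \<in> Fam" by (rule arc_cluster[OF c])
  have r: "rot i c \<in> C" for i using c by (rule rot_circles)
  have "A.arc_count \<le> K + 1 - 2 * (\<Sum>i\<in>{0..<N}. of_bool (spread_run (rot i c)))"
  proof (rule A.arc_count_tight_deficit[OF NN, where D = "\<lambda>i. spread_run (rot i c)"])
    show "spread_run (rot (x + N) c) \<longleftrightarrow> spread_run (rot x c)" for x using rot_N[OF c] by simp
    show "A.col x = 0 \<and> A.col (x + 1) = 0 \<and> A.col (x - 1) \<noteq> 2" if "spread_run (rot x c)" for x
      using spread_run_col[OF NN r that] unfolding arc_rot A.col_eq_0 A.col_eq_2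
      by (auto simp: algebra_simps)
    show "\<not> spread_run (rot (x + 1) c) \<and> \<not> spread_run (rot (x + K + 1) c) \<and> \<not> spread_run (rot (x + K + 2) c)"
      if "spread_run (rot x c)" for x
      using spread_run_incompatible_tight[OF NN r that] spread_run_incompatible_far[OF r that, of "K + 1"] KN NN
      unfolding rot_rot by (auto simp: algebra_simps)
  qed
  then show ?thesis using pos unfolding arc_cnt_eq[OF c] spread_run_cnt_def by linarith
next
  case False
  then have NN: "2 * K + 3 \<le> N" using KN by simp
  have near: "\<not> spread_run (rot j c)" if "spread_run (rot i c)" "i < j" "2 * (j - i) \<le> N" for i j
  proof
    assume lj: "spread_run (rot j c)"
    have r: "rot i c \<in> C" using c by (rule rot_circles)
    have "spread_run (rot (j - i) (rot i c))" using lj by (simp add: rot_rot)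
    then show False
      using spread_run_incompatible_far[OF r that(1), of "j - i"] spread_run_incompatible_near[OF _ r that(1), of "j - i"]
        that NN KN by (cases "j - i \<le> K") auto
  qed
  have uniq: "i = j" if "spread_run (rot i c)" "spread_run (rot j c)" "i \<in> {0..<N}" "j \<in> {0..<N}" "i \<le> j" for i j
  proof (rule ccontr)
    \<comment> \<open>If \<open>j\<close> is more than half a turn after \<open>i\<close>, then
      \<open>i + N\<close> is less than half a turn after \<open>j\<close>.\<close>
    assume "i \<noteq> j"
    then have "2 * (j - i) > N" using near[OF that(1), of j] that by force
    moreover have "spread_run (rot (i + N) c)" using that rot_N[OF c] by simp
    ultimately show False using near[OF that(2), of "i + N"] that by auto
  qed
  have "\<exists>i\<in>{0..<N}. spread_run (rot i c)"
  proof (rule ccontr)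
    assume "\<not> ?thesis"
    then have "spread_run_cnt c = 0" unfolding spread_run_cnt_def by (intro sum.neutral) auto
    then show False using pos by simp
  qed
  then obtain i where i: "i \<in> {0..<N}" "spread_run (rot i c)" by blast
  have "spread_run (rot j c) \<longleftrightarrow> j = i" if "j \<in> {0..<N}" for j
    using uniq[of i j] uniq[of j i] i that linear[of i j] by blast
  then have "spread_run_cnt c = (\<Sum>j\<in>{0..<N}. if j = i then 1 else 0)" unfolding spread_run_cnt_def by (intro sum.cong) auto
  also have "\<dots> = 1" using i(1) by (subst sum.delta) auto
  finally have l1: "spread_run_cnt c = 1" .
  have r: "rot i c \<in> C" using c by (rule rot_circles)
  interpret A: arc_cluster N K "\<lambda>s. ar (rot i c) s \<in> Fam" by (rule arc_cluster[OF r])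
  have "A.arc_count \<le> K - 1"
    by (rule A.arc_count_wide_deficit[OF NN]) (use spread_run_range[OF r i(2)] in blast)
  then show ?thesis using l1 arc_cnt_eq[OF r] arc_cnt_rot[OF c] by simp
qed

lemma spread_run_cnt_rot: assumes "c \<in> C" shows "spread_run_cnt (rot i c) = spread_run_cnt c"
  unfolding spread_run_cnt_def rot_rot
  by (rule sum_periodic_shift[where g = "\<lambda>i. of_bool (spread_run (rot i c))"])
     (use KN rot_N[OF assms] in simp_all)

section \<open>Alternating configurations and their swapped forms\<close>

text \<open>These are the arcs at \<open>p + 1\<close> and \<open>p + 1 - K\<close> after exchanging
  \<open>p\<close> and \<open>p + 1\<close>. Each is disjoint from a member whose opposite member
  overlaps it without being equal to it.\<close>

lemma alt_shifted:
  assumes c: "c \<in> C" and alt: "alt c" and p: "odd p"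
  shows "c ` ({p} \<union> {p + 2..p + K}) \<notin> Fam" "c ` ({p + 1 - K..p - 1} \<union> {p + 1}) \<notin> Fam"
proof -
  have NN: "N = 2 * K + 2" and oK: "odd K" and F: "ar c s \<in> Fam \<longleftrightarrow> even s" for s
    using alt by (auto simp: alt_def)
  show "c ` ({p} \<union> {p + 2..p + K}) \<notin> Fam"
  proof
    let ?X = "{p} \<union> {p + 2..p + K}"
    assume X: "c ` ?X \<in> Fam"
    have Xb: "?X \<subseteq> {p..p + K}" using KN by auto
    have "c ` ?X \<inter> ar c (p + K + 2) = {}" unfolding arc_def
      by (rule circles_image_disjoint[OF c Xb arc_bounds]) (use KN NN in auto)
    moreover have "ar c (p + 1) \<inter> ar c (p + K + 2) = {}" unfolding arc_def
      by (rule circles_image_disjoint[OF c arc_bounds arc_bounds]) (use KN NN in auto)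
    then have "ar c (p + K + 2) \<inter> ar c (p + 1) = {}" by (simp only: inf_commute)
    moreover have "ar c (p + K + 2) \<in> Fam" "ar c (p + 1) \<in> Fam" using p oK F by auto
    ultimately have "c ` ?X = ar c (p + 1) \<or> c ` ?X \<inter> ar c (p + 1) = {}" using trans[OF X] by metis
    moreover have "c (p + 2) \<in> c ` ?X" "c (p + 2) \<in> ar c (p + 1)" using KN by (auto simp: arc_def)
    ultimately have "c ` ?X = ar c (p + 1)" by (metis IntI empty_iff)
    moreover have "c p \<in> c ` ?X" by auto
    ultimately have "c p \<in> c ` {p + 1..<p + 1 + K}" by (simp only: arc_def)
    then have "p \<in> {p + 1..<p + 1 + K}"
      by (subst (asm) circles_mem_image[OF c, of _ p]) (use KN in auto)
    then show False by simp
  qed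
  show "c ` ({p + 1 - K..p - 1} \<union> {p + 1}) \<notin> Fam"
  proof
    let ?X = "{p + 1 - K..p - 1} \<union> {p + 1}"
    assume X: "c ` ?X \<in> Fam"
    have Xb: "?X \<subseteq> {p + 1 - K..p + 1}" using KN by auto
    have "c ` ?X \<inter> ar c (p + 3) = {}" unfolding arc_def
      by (rule circles_image_disjoint[OF c Xb arc_bounds]) (use KN NN in auto)
    moreover have "ar c (p + 2 - K) \<inter> ar c (p + 3) = {}" unfolding arc_def
      by (rule circles_image_disjoint[OF c arc_bounds arc_bounds]) (use KN NN in auto)
    then have "ar c (p + 3) \<inter> ar c (p + 2 - K) = {}" by (simp only: inf_commute)
    moreover have "ar c (p + 3) \<in> Fam" "ar c (p + 2 - K) \<in> Fam" using p oK F by auto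
    ultimately have "c ` ?X = ar c (p + 2 - K) \<or> c ` ?X \<inter> ar c (p + 2 - K) = {}" using trans[OF X] by metis
    moreover have "c (p - 1) \<in> c ` ?X" "c (p - 1) \<in> ar c (p + 2 - K)" using KN by (auto simp: arc_def)
    ultimately have "c ` ?X = ar c (p + 2 - K)" by (metis IntI empty_iff)
    moreover have "c (p + 1 - K) \<in> c ` ?X" using KN by auto
    ultimately have "c (p + 1 - K) \<in> c ` {p + 2 - K..<p + 2 - K + K}" by (simp only: arc_def)
    then have "p + 1 - K \<in> {p + 2 - K..<p + 2 - K + K}"
      by (subst (asm) circles_mem_image[OF c, of _ "p + 1 - K"]) (use KN in auto)
    then show False by simp
  qed
qed

abbreviation swap_pos :: "int \<Rightarrow> int" where "swap_pos \<equiv> lift_perm N swap2"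

lemma swap_pos_inverse: "swap_pos (swap_pos x) = x"
  by (rule lift_perm_inverse; use KN in \<open>auto simp: swap2_def\<close>)

definition alt_swapped :: "(int \<Rightarrow> 'a) \<Rightarrow> bool" where "alt_swapped c \<longleftrightarrow> alt (c \<circ> swap_pos)"

text \<open>The window lies above the copies of 1 to 4 shifted by \<open>-N\<close>, so arcs may
  start at negative places without reduction modulo \<open>N\<close>.\<close>

lemma swap_pos_near: assumes "x \<in> {5 - N..<N}" shows "swap_pos x = swap2 x"
proof (cases "x \<ge> 0")
  case True then show ?thesis using assms by (simp add: lift_perm_fundamental)
next
  case False
  have "swap_pos (x + N) = swap_pos x + N" using KN by (intro lift_perm_shift) simp
  moreover have "swap_pos (x + N) = swap2 (x + N)" using False assms by (intro lift_perm_fundamental) auto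
  ultimately show ?thesis using False assms by (auto simp: swap2_def)
qed

text \<open>Only arcs with a boundary between 1 and 2 or between 3 and 4 are changed, and
  \<open>alt_shifted\<close> excludes all four of them.\<close>

lemma alt_swapped_arcs_near:
  assumes d: "d \<in> C" and b: "alt_swapped d" and s: "s \<in> {5 - N..4}"
  shows "ar d s \<in> Fam \<longleftrightarrow> even s \<and> s \<noteq> 2 \<and> s \<noteq> 4"
proof -
  define c where "c = d \<circ> swap_pos"
  have alt: "alt c" using b by (simp add: alt_swapped_def c_def)
  have c: "c \<in> C" unfolding c_def
    by (rule circles_comp[OF d, where q = swap_pos]) (use KN in \<open>auto simp: swap_pos_inverse lift_perm_shift\<close>)
  have oK: "odd K" and F: "ar c s \<in> Fam \<longleftrightarrow> even s" for s using alt by (auto simp: alt_def)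
  have "d = c \<circ> swap_pos" by (simp add: c_def fun_eq_iff swap_pos_inverse)
  then have "ar d s = c ` swap_pos ` {s..<s + K}" by (simp add: arc_def image_comp)
  also have "swap_pos ` {s..<s + K} = swap2 ` {s..<s + K}"
    by (rule image_cong) (use s KN in \<open>auto intro!: swap_pos_near\<close>)
  finally have ar: "ar d s = c ` swap2 ` {s..<s + K}" .
  have inv: "swap2 (swap2 x) = x" for x by (auto simp: swap2_def)
  have img: "swap2 ` A = B" if "\<And>x. x \<in> A \<Longrightarrow> swap2 x \<in> B" "\<And>x. x \<in> B \<Longrightarrow> swap2 x \<in> A" for A B
  proof
    show "swap2 ` A \<subseteq> B" using that(1) by auto
    show "B \<subseteq> swap2 ` A" using that(2) inv by (metis image_eqI subsetI)
  qed
  consider "s = 2" | "s = 4" | "s = 2 - K" | "s = 4 - K" | "s \<notin> {2, 4, 2 - K, 4 - K}" by blast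
  then show ?thesis
  proof cases
    case 1
    have "swap2 ` {s..<s + K} = {1} \<union> {1 + 2..1 + K}"
      by (rule img) (use 1 KN in \<open>auto simp: swap2_def split: if_splits\<close>)
    then show ?thesis using 1 alt_shifted(1)[OF c alt, of 1] ar by simp
  next
    case 2
    have "swap2 ` {s..<s + K} = {3} \<union> {3 + 2..3 + K}"
      by (rule img) (use 2 KN in \<open>auto simp: swap2_def split: if_splits\<close>)
    then show ?thesis using 2 alt_shifted(1)[OF c alt, of 3] ar by simp
  next
    case 3
    have "swap2 ` {s..<s + K} = {1 + 1 - K..1 - 1} \<union> {1 + 1}"
      by (rule img) (use 3 KN in \<open>auto simp: swap2_def split: if_splits\<close>)
    then show ?thesis using 3 alt_shifted(2)[OF c alt, of 1] ar oK by simp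
  next
    case 4
    have "swap2 ` {s..<s + K} = {3 + 1 - K..3 - 1} \<union> {3 + 1}"
      by (rule img) (use 4 KN in \<open>auto simp: swap2_def split: if_splits\<close>)
    then show ?thesis using 4 alt_shifted(2)[OF c alt, of 3] ar oK by simp
  next
    case 5
    have "swap2 ` {s..<s + K} = {s..<s + K}"
      by (rule img) (use 5 KN in \<open>auto simp: swap2_def split: if_splits\<close>)
    then show ?thesis using 5 ar F[of s] by (simp add: arc_def)
  qed
qed

lemma alt_swapped_deficit:
  assumes c: "c \<in> C" and b: "alt_swapped c"
  shows "arc_cnt c \<le> K - 1" "spread_run_cnt c = 0" "\<not> alt_swapped (rot 1 c)"
proof -
  have NN: "N = 2 * K + 2" and oK: "odd K" using b by (auto simp: alt_swapped_def alt_def)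
  have arcs: "ar c s \<in> Fam \<longleftrightarrow> even s \<and> s \<noteq> 2 \<and> s \<noteq> 4" if "s \<in> {0..<N}" for s
  proof (cases "s \<le> 4")
    case True
    then show ?thesis using alt_swapped_arcs_near[OF c b, of s] that KN by simp
  next
    case False
    have "ar c s = ar c (s - N)" by (rule arc_periodic[OF c]) simp
    then show ?thesis using alt_swapped_arcs_near[OF c b, of "s - N"] that False NN by simp
  qed
  have "arc_cnt c = int (card {s\<in>{0..<N}. ar c s \<in> Fam})" by (simp add: arc_cnt_def Int_def)
  \<comment> \<open>Halving the even starts sends the missing 2 and 4 to 1 and 2.\<close>
  also have "card {s\<in>{0..<N}. ar c s \<in> Fam} \<le> card ({0..K} - {1, 2})"
  proof (rule card_inj_on_le)
    show "inj_on (\<lambda>s. s div 2) {s\<in>{0..<N}. ar c s \<in> Fam}"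
      using arcs by (auto simp: inj_on_def elim!: evenE)
    show "(\<lambda>s. s div 2) ` {s\<in>{0..<N}. ar c s \<in> Fam} \<subseteq> {0..K} - {1, 2}"
      using arcs NN by (auto elim!: evenE)
  qed simp
  also have "int (card ({0..K} - {1, 2})) = K - 1" using KN by (subst card_Diff_subset) auto
  finally show "arc_cnt c \<le> K - 1" by simp
  have "\<not> spread_run (rot i c)" for i
  proof
    assume l: "spread_run (rot i c)"
    \<comment> \<open>A spread run empties the columns \<open>i\<close> and \<open>i + 1\<close>,
      and \<open>e\<close> is the even one. Its two arcs start at even places \<open>K + 1\<close>
      apart, so they cannot both be among the missing 2 and 4.\<close>
    define e where "e = (if even i then i else i + 1)"
    have "even e" by (simp add: e_def)
    have no: "ar c e \<notin> Fam" "ar c (e + K + 1) \<notin> Fam"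
      using spread_run_col[OF NN rot_circles[OF c] l] by (auto simp: arc_rot e_def algebra_simps)
    define y where "y = e mod N"
    have y: "y \<in> {0..<N}" using KN by (simp add: y_def)
    have "even y" using \<open>even e\<close> NN by (simp add: y_def dvd_mod_iff)
    have "ar c y = ar c e" by (rule arc_periodic[OF c]) (simp add: y_def)
    then have "y = 2 \<or> y = 4" using no arcs[OF y] \<open>even y\<close> by auto
    moreover have "ar c (y + K + 1) = ar c (e + K + 1)"
      by (rule arc_periodic[OF c]) (simp add: y_def mod_simps add.assoc)
    ultimately show False using no(2) arcs[of "y + K + 1"] \<open>even y\<close> oK NN KN by auto
  qed
  then show "spread_run_cnt c = 0" by (simp add: spread_run_cnt_def)
  show "\<not> alt_swapped (rot 1 c)"
  proof
    assume "alt_swapped (rot 1 c)"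
    then have "ar (rot 1 c) (-1) \<notin> Fam" using alt_swapped_arcs_near[OF rot_circles[OF c], of 1 "-1"] KN by simp
    then show False using arcs[of 0] KN by (simp add: arc_rot)
  qed
qed

section \<open>Balancing excess against deficit\<close>

definition run_cnt :: "(int \<Rightarrow> 'a) \<Rightarrow> int" where
  "run_cnt c = (\<Sum>i\<in>{0..<N}. of_bool (run (rot i c)))"

text \<open>Deficit circles have room for the subtracted terms; on all others the added terms cover
  a possible excess of 1.\<close>

lemma arc_cnt_le:
  assumes c: "c \<in> C"
  shows "arc_cnt c \<le> K + (run_cnt c - spread_run_cnt c)
    + (of_bool (alt c) + of_bool (alt (rot 1 c)) - (of_bool (alt_swapped c) + of_bool (alt_swapped (rot 1 c))))"
proof -
  have r: "rot 1 c \<in> C" using c by (rule rot_circles)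
  have nn: "run_cnt c \<ge> 0" "spread_run_cnt c \<ge> 0" by (auto simp: run_cnt_def spread_run_cnt_def intro!: sum_nonneg)
  consider "alt_swapped c" | "alt_swapped (rot 1 c)" "\<not> alt_swapped c" | "\<not> alt_swapped c" "\<not> alt_swapped (rot 1 c)" "spread_run_cnt c > 0"
    | "\<not> alt_swapped c" "\<not> alt_swapped (rot 1 c)" "spread_run_cnt c = 0" using nn by linarith
  then show ?thesis
  proof cases
    case 1
    then show ?thesis using alt_swapped_deficit[OF c 1] nn by simp
  next
    case 2
    then show ?thesis using alt_swapped_deficit[OF r 2(1)] nn arc_cnt_rot[OF c] spread_run_cnt_rot[OF c] by simp
  next
    case 3
    then show ?thesis using spread_run_cnt_deficit[OF c 3(3)] nn by simp
  next
    case 4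
    have "run_cnt c \<ge> 1" if "i \<in> {0..<N}" "run (rot i c)" for i
    proof -
      have "(of_bool (run (rot i c)) :: int) \<le> run_cnt c" unfolding run_cnt_def
        by (rule member_le_sum[OF that(1)]) auto
      then show ?thesis using that(2) by simp
    qed
    then show ?thesis using arc_cnt_excess[OF c] 4 nn by auto
  qed
qed

text \<open>The corrections in \<open>arc_cnt_le\<close> cancel in the sum, since
  \<open>spread\<close> and \<open>swap_pos\<close> match \<open>spread_run\<close> with
  \<open>run\<close> and \<open>alt_swapped\<close> with \<open>alt\<close>.\<close>

lemma sum_cnt_le: "(\<Sum>c\<in>C. arc_cnt c) \<le> K * int (card C)"
proof -
  have sp: "(\<Sum>c\<in>C. of_bool (spread_run c) :: int) = (\<Sum>c\<in>C. of_bool (run c))" unfolding spread_run_def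
    by (rule sum_circles_comp[where q = spread' and g = "\<lambda>c. of_bool (run c)"])
       (use KN in \<open>auto simp: spread_inverse lift_perm_shift\<close>)
  have "(\<Sum>c\<in>C. spread_run_cnt c) = (\<Sum>i\<in>{0..<N}. \<Sum>c\<in>C. of_bool (spread_run (rot i c)))"
    unfolding spread_run_cnt_def by (rule sum.swap)
  also have "\<dots> = (\<Sum>i\<in>{0..<N}. \<Sum>c\<in>C. of_bool (run (rot i c)))"
    using sum_circles_rot[where g = "\<lambda>c. of_bool (spread_run c) :: int"]
      sum_circles_rot[where g = "\<lambda>c. of_bool (run c) :: int"] sp by metis
  also have "\<dots> = (\<Sum>c\<in>C. run_cnt c)" unfolding run_cnt_def by (rule sum.swap)
  finally have l: "(\<Sum>c\<in>C. spread_run_cnt c) = (\<Sum>c\<in>C. run_cnt c)" .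
  have b: "(\<Sum>c\<in>C. of_bool (alt_swapped c) :: int) = (\<Sum>c\<in>C. of_bool (alt c))" unfolding alt_swapped_def
    by (rule sum_circles_comp[where q = swap_pos and g = "\<lambda>c. of_bool (alt c)"])
       (use KN in \<open>auto simp: swap_pos_inverse lift_perm_shift\<close>)
  have b1: "(\<Sum>c\<in>C. of_bool (alt_swapped (rot 1 c)) :: int) = (\<Sum>c\<in>C. of_bool (alt (rot 1 c)))"
    using sum_circles_rot[where g = "\<lambda>c. of_bool (alt_swapped c) :: int"]
      sum_circles_rot[where g = "\<lambda>c. of_bool (alt c) :: int"] b by metis
  have "(\<Sum>c\<in>C. arc_cnt c) \<le> (\<Sum>c\<in>C. K + (run_cnt c - spread_run_cnt c)
    + (of_bool (alt c) + of_bool (alt (rot 1 c)) - (of_bool (alt_swapped c) + of_bool (alt_swapped (rot 1 c)))))"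
    by (rule sum_mono) (rule arc_cnt_le)
  also have "\<dots> = (\<Sum>c\<in>C. K)"
    unfolding sum.distrib sum_subtractf l b b1 by linarith
  finally show ?thesis by (simp add: mult.commute)
qed

lemma card_cluster_family: "card Fam \<le> (n - 1) choose (k - 1)"
  using katona_average[OF V _ _ Fam] sum_cnt_le k n unfolding arc_cnt_def by simp

end

section \<open>Passing from the families to their union\<close>

theorem theorem4:
  fixes n k h :: nat and \<F> :: "nat \<Rightarrow> nat set set"
  assumes "n \<ge> 2 * k + 2" and "k \<ge> 4"
    and "\<And>i. i \<in> {1..h} \<Longrightarrow> \<F> i \<subseteq> {A. A \<subseteq> {1..n} \<and> card A = k}"
    and "\<And>i j. 1 \<le> i \<Longrightarrow> i < j \<Longrightarrow> j \<le> h \<Longrightarrow> \<F> i \<inter> \<F> j = {}"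
    and "\<And>i F F'. i \<in> {1..h} \<Longrightarrow> F \<in> \<F> i \<Longrightarrow> F' \<in> \<F> i \<Longrightarrow> F \<noteq> F' \<Longrightarrow> F \<inter> F' = {}"
    and "\<And>i j F G. 1 \<le> i \<Longrightarrow> i < j \<Longrightarrow> j \<le> h \<Longrightarrow> F \<in> \<F> i \<Longrightarrow> G \<in> \<F> j \<Longrightarrow> F \<inter> G \<noteq> {}"
  shows "(\<Sum>i=1..h. card (\<F> i)) \<le> (n - 1) choose (k - 1)"
proof -
  define Fam where "Fam = (\<Union>i\<in>{1..h}. \<F> i)"
  have Fam: "Fam \<subseteq> {A. A \<subseteq> {1..n} \<and> card A = k}" unfolding Fam_def by (rule UN_least) (rule assms(3))
  have finU: "finite {A. A \<subseteq> {1..n} \<and> card A = k}" by simp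
  have finF: "finite (\<F> i)" if "i \<in> {1..h}" for i using assms(3)[OF that] finU by (rule finite_subset)
  have "card Fam = (\<Sum>i=1..h. card (\<F> i))" unfolding Fam_def
  proof (rule card_UN_disjoint)
    show "\<forall>i\<in>{1..h}. \<forall>j\<in>{1..h}. i \<noteq> j \<longrightarrow> \<F> i \<inter> \<F> j = {}"
      using assms(4) by (metis atLeastAtMost_iff inf_commute linorder_neqE_nat)
  qed (use finF in auto)
  moreover have "card Fam \<le> (n - 1) choose (k - 1)"
  proof -
    have same: "i = j" if "i \<in> {1..h}" "j \<in> {1..h}" "X \<in> \<F> i" "Y \<in> \<F> j" "X \<inter> Y = {}" for i j X Y
      using assms(6) that by (metis atLeastAtMost_iff inf_commute linorder_neqE_nat)
    show ?thesis
    proof (cases "\<exists>S\<subseteq>Fam. (\<forall>X\<in>S. \<forall>Y\<in>S. X \<noteq> Y \<longrightarrow> X \<inter> Y = {}) \<and> card S > k")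
      case False
      interpret cluster_family "{1..n}" n k Fam
      proof
        show "X = Z \<or> X \<inter> Z = {}"
          if m: "X \<in> Fam" "Y \<in> Fam" "Z \<in> Fam" and d: "X \<inter> Y = {}" "Y \<inter> Z = {}" for X Y Z
        proof -
          obtain i j l where ijl: "i \<in> {1..h}" "X \<in> \<F> i" "j \<in> {1..h}" "Y \<in> \<F> j" "l \<in> {1..h}" "Z \<in> \<F> l"
            using m by (auto simp: Fam_def)
          then have "i = j" "j = l" using same d by blast+
          then show ?thesis using assms(5)[of i X Z] ijl by auto
        qed
        show "card S \<le> k"
          if "S \<subseteq> Fam" "\<And>X Y. X \<in> S \<Longrightarrow> Y \<in> S \<Longrightarrow> X \<noteq> Y \<Longrightarrow> X \<inter> Y = {}" for S
          using False that by (meson not_le)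
      qed (use assms Fam in auto)
      show ?thesis by (rule card_cluster_family)
    next
      case True
      then obtain S where S0: "S \<subseteq> Fam \<and> (\<forall>X\<in>S. \<forall>Y\<in>S. X \<noteq> Y \<longrightarrow> X \<inter> Y = {}) \<and> card S > k" ..
      then have S: "S \<subseteq> Fam" "card S > k" by simp_all
      from S0 have Sd: "X \<inter> Y = {}" if "X \<in> S" "Y \<in> S" "X \<noteq> Y" for X Y
        using that by simp_all
      have fin: "finite X" if "X \<in> Fam" for X using that Fam finite_subset[of X "{1..n}"] by auto
      \<comment> \<open>A \<open>k\<close>-set cannot meet more than \<open>k\<close> pairwise disjoint sets.\<close>
      have miss: "\<exists>Y\<in>S. X \<inter> Y = {}" if X: "X \<in> Fam" for X
      proof (rule ccontr)
        assume "\<not> ?thesis"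
        then have "\<forall>Y\<in>S. \<exists>x. x \<in> X \<inter> Y" by (metis all_not_in_conv)
        then obtain f where f: "\<And>Y. Y \<in> S \<Longrightarrow> f Y \<in> X \<inter> Y" by metis
        have "inj_on f S"
        proof (rule inj_onI, rule ccontr)
          fix Y Z assume "Y \<in> S" "Z \<in> S" "f Y = f Z" "Y \<noteq> Z"
          then show False using Sd[of Y Z] f[of Y] f[of Z] by auto
        qed
        then have "card S \<le> card X" using f fin[OF X] by (intro card_inj_on_le) auto
        moreover have "card X = k" using X Fam by auto
        ultimately show False using S(2) by simp
      qed
      \<comment> \<open>Each member misses some set of \<open>S\<close>, hence shares a family with
        all of \<open>S\<close>. As \<open>S\<close> is nonempty, there is only one such
        family.\<close>
      have pw: "X \<inter> Y = {}" if "X \<in> Fam" "Y \<in> Fam" "X \<noteq> Y" for X Y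
      proof -
        have idx: "\<exists>i\<in>{1..h}. X \<in> \<F> i \<and> S \<subseteq> \<F> i" if X: "X \<in> Fam" for X
        proof -
          obtain i where i: "i \<in> {1..h}" "X \<in> \<F> i" using X by (auto simp: Fam_def)
          obtain Y where Y: "Y \<in> S" "X \<inter> Y = {}" using miss[OF X] by blast
          obtain j where j: "j \<in> {1..h}" "Y \<in> \<F> j" using Y S(1) by (auto simp: Fam_def)
          have "j = i" using same[OF i(1) j(1) i(2) j(2) Y(2)] by simp
          have "Z \<in> \<F> i" if Z: "Z \<in> S" for Z
          proof (cases "Z = Y")
            case False
            obtain l where l: "l \<in> {1..h}" "Z \<in> \<F> l" using Z S(1) by (auto simp: Fam_def)
            then have "l = j" using same[OF l(1) j(1) l(2) j(2)] Sd[OF Z Y(1) False] by blast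
            then show ?thesis using l \<open>j = i\<close> by simp
          qed (use j \<open>j = i\<close> in simp)
          then show ?thesis using i by blast
        qed
        obtain i where i: "i \<in> {1..h}" "X \<in> \<F> i" "S \<subseteq> \<F> i" using idx \<open>X \<in> Fam\<close> by blast
        obtain j where j: "j \<in> {1..h}" "Y \<in> \<F> j" "S \<subseteq> \<F> j" using idx \<open>Y \<in> Fam\<close> by blast
        have "i = j"
        proof (rule ccontr)
          assume "i \<noteq> j"
          then have "\<F> i \<inter> \<F> j = {}" using assms(4) i(1) j(1)
            by (metis atLeastAtMost_iff inf_commute linorder_neqE_nat)
          then have "S = {}" using i j by blast
          then show False using S(2) by simp
        qed
        then show ?thesis using assms(5) i j that by blast
      qed
      have "card (\<Union>Fam) = sum card Fam"
        by (rule card_Union_disjoint) (use pw fin in \<open>auto simp: pairwise_def disjnt_def\<close>)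
      also have "\<dots> = (\<Sum>X\<in>Fam. k)" using Fam by (intro sum.cong) auto
      finally have "card (\<Union>Fam) = card Fam * k" by simp
      moreover have "card (\<Union>Fam) \<le> card {1..n}" using Fam by (intro card_mono) auto
      ultimately have le: "card Fam * k \<le> n" by simp
      have "card Fam * 4 \<le> card Fam * k" using assms(2) by simp
      then have "card Fam \<le> n - 1" using le assms(1,2) by linarith
      also have "n - 1 = (n - 1) choose 1" by simp
      \<comment> \<open>Binomial coefficients increase up to the middle, and \<open>k - 1\<close> is
        below half of \<open>n - 1\<close>.\<close>
      also have "\<dots> \<le> (n - 1) choose (k - 1)" using assms(1,2) by (intro binomial_mono) auto
      finally show ?thesis .
    qed
  qed
  ultimately show ?thesis by simp
qed

end
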